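(* Let $u_0$ be sufficiently smooth, let $u$ be a (sufficiently smooth) classical solution of the KdV Cauchy problem $u_t+uu_x+u_{xxx}=0$ on $\mathbb{R}\times(0,T)$, $u(\cdot,0)=u_0$, and let $u^n$ be the approximate solution generated by $$u_j^{n+1} = u_j^n -\Delta t\, \tilde{u}_j^{n+1/2}\, Du_j^{n+1/2} - \Delta t\, D_-DD_+u^{n+1/2}_j,\quad n\in\mathbb{N}_0,\ j\in\mathbb{Z},\qquad u_j^0=u_0(x_j).$$ Then for $t_n\le T$ there holds $$\|u^n-u(t_n)\|\le C(u,T)\big(\Delta x^2+\Delta t^2\big),$$ where $C(u,T)$ is a constant that may depend on $u$ and $T$ but is independent of $\Delta x$ and $\Delta t$.
   Context: Grid: $x_j=j\Delta x$, $j\in\mathbb{Z}$, $t_n=n\Delta t$, $n\in\mathbb{N}_0$. For a grid function $v=(v_j)$: $D_+v_j=(v_{j+1}-v_j)/\Delta x$, $D_-v_j=(v_j-v_{j-1})/\Delta x$, $D=\frac12(D_++D_-)$, $\tilde v_j=\frac13(v_{j+1}+v_j+v_{j-1})$, $\|v\|=(\Delta x\sum_jv_j^2)^{1/2}$; $u^{n+1/2}=\frac12(u^n+u^{n+1})$. In $\|u^n-u(t_n)\|$, $u(t_n)$ denotes the grid function $(u(x_j,t_n))_j$. *)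

theory Defs
  imports "HOL-Analysis.Analysis"
begin

definition Dplus :: "real \<Rightarrow> (int \<Rightarrow> real) \<Rightarrow> int \<Rightarrow> real" where
  "Dplus \<Delta>x v j = (v (j + 1) - v j) / \<Delta>x"

definition Dminus :: "real \<Rightarrow> (int \<Rightarrow> real) \<Rightarrow> int \<Rightarrow> real" where
  "Dminus \<Delta>x v j = (v j - v (j - 1)) / \<Delta>x"

definition Dcentral :: "real \<Rightarrow> (int \<Rightarrow> real) \<Rightarrow> int \<Rightarrow> real" where
  "Dcentral \<Delta>x v j = (Dplus \<Delta>x v j + Dminus \<Delta>x v j) / 2"

definition grid_avg :: "(int \<Rightarrow> real) \<Rightarrow> int \<Rightarrow> real" where
  "grid_avg v j = (v (j + 1) + v j + v (j - 1)) / 3"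

definition ell2 :: "(int \<Rightarrow> real) \<Rightarrow> bool" where
  "ell2 v \<longleftrightarrow> (\<lambda>j. (v j)\<^sup>2) summable_on UNIV"

text \<open>Meaningful only for \<open>v\<close> with \<open>ell2 v\<close>: \<open>infsum\<close> is 0 for families that are not summable.\<close>
definition grid_norm :: "real \<Rightarrow> (int \<Rightarrow> real) \<Rightarrow> real" where
  "grid_norm \<Delta>x v = sqrt (\<Delta>x * (\<Sum>\<^sub>\<infinity>j. (v j)\<^sup>2))"

definition half_step :: "(nat \<Rightarrow> int \<Rightarrow> real) \<Rightarrow> nat \<Rightarrow> int \<Rightarrow> real" where
  "half_step U n j = (U n j + U (Suc n) j) / 2"

text \<open>The scheme is implicit: it determines \<open>U (Suc n)\<close> through an equation on the whole grid,
  which is solved in the space of grid functions of finite norm. Without this requirement the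
  equation leaves free parameters and admits solutions that grow in \<open>j\<close>.\<close>
definition kdv_scheme ::
  "real \<Rightarrow> real \<Rightarrow> (real \<Rightarrow> real) \<Rightarrow> (nat \<Rightarrow> int \<Rightarrow> real) \<Rightarrow> bool" where
  "kdv_scheme \<Delta>x \<Delta>t u0 U \<longleftrightarrow>
     (\<forall>n. ell2 (U n)) \<and>
     (\<forall>j. U 0 j = u0 (of_int j * \<Delta>x)) \<and>
     (\<forall>n j. U (Suc n) j = U n j
        - \<Delta>t * grid_avg (half_step U n) j * Dcentral \<Delta>x (half_step U n) j
        - \<Delta>t * Dminus \<Delta>x (Dcentral \<Delta>x (Dplus \<Delta>x (half_step U n))) j)"

text \<open>Smoothness of order \<open>m\<close> on the whole line includes square integrability of the derivatives
  (that is, membership in \<open>C\<^sup>m \<inter> H\<^sup>m\<close>), since errors are measured in a discrete \<open>L\<^sup>2\<close> norm.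
  Here \<open>d i\<close> is the \<open>i\<close>-th derivative of \<open>f\<close>.\<close>
definition smooth_line :: "nat \<Rightarrow> (real \<Rightarrow> real) \<Rightarrow> bool" where
  "smooth_line m f \<longleftrightarrow> (\<exists>d :: nat \<Rightarrow> real \<Rightarrow> real.
     d 0 = f \<and>
     (\<forall>i<m. \<forall>x. (d i has_real_derivative d (Suc i) x) (at x)) \<and>
     (\<forall>i\<le>m. continuous_on UNIV (d i) \<and> integrable lborel (\<lambda>x. (d i x)\<^sup>2)))"

text \<open>The analogue for functions \<open>u x t\<close> on the strip with \<open>0 \<le> t \<le> T\<close>: \<open>w a b\<close> is the partial
  derivative of order \<open>a\<close> in \<open>x\<close> and \<open>b\<close> in \<open>t\<close> (one-sided in \<open>t\<close> at the end points), and the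
  \<open>L\<^sup>2\<close> norms in \<open>x\<close> are bounded uniformly in \<open>t\<close>.\<close>
definition smooth_strip :: "nat \<Rightarrow> real \<Rightarrow> (real \<Rightarrow> real \<Rightarrow> real) \<Rightarrow> bool" where
  "smooth_strip m T u \<longleftrightarrow> (\<exists>w :: nat \<Rightarrow> nat \<Rightarrow> real \<Rightarrow> real \<Rightarrow> real.
     (\<forall>x. \<forall>t\<in>{0..T}. w 0 0 x t = u x t) \<and>
     (\<forall>a b. a + b < m \<longrightarrow> (\<forall>x. \<forall>t\<in>{0..T}.
        ((\<lambda>y. w a b y t) has_real_derivative w (Suc a) b x t) (at x) \<and>
        ((\<lambda>s. w a b x s) has_real_derivative w a (Suc b) x t) (at t within {0..T}))) \<and>
     (\<forall>a b. a + b \<le> m \<longrightarrow>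
        continuous_on (UNIV \<times> {0..T}) (\<lambda>(x, t). w a b x t) \<and>
        (\<exists>M. \<forall>t\<in>{0..T}. integrable lborel (\<lambda>x. (w a b x t)\<^sup>2) \<and>
                         (LINT x|lborel. (w a b x t)\<^sup>2) \<le> M)))"

definition kdv_classical_solution ::
  "real \<Rightarrow> (real \<Rightarrow> real) \<Rightarrow> (real \<Rightarrow> real \<Rightarrow> real) \<Rightarrow> bool" where
  "kdv_classical_solution T u0 u \<longleftrightarrow>
     (\<forall>x. u x 0 = u0 x) \<and>
     (\<exists>ut ux uxx uxxx. \<forall>x. \<forall>t\<in>{0<..<T}.
        ((\<lambda>s. u x s) has_real_derivative ut x t) (at t) \<and>
        ((\<lambda>y. u y t) has_real_derivative ux x t) (at x) \<and>
        ((\<lambda>y. ux y t) has_real_derivative uxx x t) (at x) \<and>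
        ((\<lambda>y. uxx y t) has_real_derivative uxxx x t) (at x) \<and>
        ut x t + u x t * ux x t + uxxx x t = 0)"

end

theory Submission
  imports Defs
begin

text \<open>
  The scheme is a stable and consistent discretisation, and both properties are read off from an
  energy argument in the discrete \<open>L\<^sup>2\<close> norm that places no restriction on the ratio of the mesh
  sizes. Write \<open>h\<close>, \<open>k\<close> for \<open>\<Delta>x\<close>, \<open>\<Delta>t\<close>.

  Stability. The midpoint rule turns the difference of the squared norms at two consecutive levels
  into \<open>2 k\<close> times the inner product of the half-step value with the right-hand side. There the
  dispersive term vanishes because \<open>D\<^sub>- D D\<^sub>+\<close> is skew-symmetric, and the convective term vanishes
  because the average over three neighbours makes \<open>v \<cdot> avg v \<cdot> D v\<close> a telescoping difference. So
  the scheme does not increase the norm (\<open>scheme_norm_le\<close>). For the error \<open>e\<close> against a grid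
  function \<open>W\<close> with Lipschitz constant \<open>L\<close>, two cross terms remain: \<open>avg e \<cdot> D W\<close> is bounded by \<open>L\<close>,
  and in \<open>avg W \<cdot> D e\<close> a summation by parts moves the difference from \<open>e\<close> to \<open>avg W\<close>
  (\<open>energy_identity\<close>, \<open>energy_step\<close>).

  Consistency. The truncation error is quadratic in \<open>h\<close> and \<open>k\<close> by Taylor expansion, but the
  remainders have to be bounded in the discrete \<open>L\<^sup>2\<close> norm, where the intermediate points of a
  pointwise Taylor theorem depend on the node. Testing the remainder against itself reduces the
  claim to the scalar Taylor theorem for a single linear combination of the nodal functions
  (\<open>grid_taylor\<close>). What it needs is a bound of the sampled derivatives that is uniform in the position
  of the grid and in time; \<open>sampling_bound\<close> gives it at the price of one further derivative. The
  expansion of \<open>D\<^sub>- D D\<^sub>+\<close> uses five derivatives, so six are enough.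

  Convergence. If \<open>h \<le> 1\<close> and \<open>k\<close> is below a constant, a discrete Gronwall argument combines the two
  parts (\<open>discrete_gronwall\<close>). If \<open>h\<close> or \<open>k\<close> is not small, the error is at most the sum of the norms of
  the two solutions, which is \<open>O(1 + h)\<close>, and this is already of order \<open>h\<^sup>2 + k\<^sup>2\<close>
  (\<open>error_bound\<close>).
\<close>

section \<open>Square-summable grid functions\<close>

text \<open>
  Norm bounds are carried by finite partial sums. In this form they include square summability, so
  no estimate has to treat summability separately, and the rules for sums, products and shifts come
  from the finite-dimensional norm \<open>L2_set\<close>. The equivalence is \<open>grid_bounded_iff\<close>.
\<close>

definition grid_bounded :: "real \<Rightarrow> real \<Rightarrow> (int \<Rightarrow> real) \<Rightarrow> bool" where
  "grid_bounded h B v \<longleftrightarrow> (\<forall>F. finite F \<longrightarrow> sqrt h * L2_set v F \<le> B)"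

lemma grid_boundedD: "grid_bounded h B v \<Longrightarrow> finite F \<Longrightarrow> sqrt h * L2_set v F \<le> B"
  by (simp add: grid_bounded_def)

lemma grid_bounded_nonneg: "grid_bounded h B v \<Longrightarrow> 0 \<le> B"
  using grid_boundedD[of h B v "{}"] by simp

lemma grid_bounded_mono: "grid_bounded h B v \<Longrightarrow> B \<le> B' \<Longrightarrow> grid_bounded h B' v"
  unfolding grid_bounded_def by force

lemma grid_bounded_weaken:
  assumes "grid_bounded h B v" "\<And>j. v j = w j" "B \<le> C"
  shows "grid_bounded h C w"
proof -
  have "v = w" using assms(2) by (simp add: fun_eq_iff)
  with grid_bounded_mono[OF assms(1,3)] show ?thesis by simp
qed

lemma grid_bounded_add:
  assumes "0 < h" "grid_bounded h B v" "grid_bounded h C w"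
  shows "grid_bounded h (B + C) (\<lambda>j. v j + w j)"
  unfolding grid_bounded_def
proof (intro allI impI)
  fix F :: "int set" assume F: "finite F"
  have "sqrt h * L2_set (\<lambda>j. v j + w j) F \<le> sqrt h * (L2_set v F + L2_set w F)"
    using assms(1) by (intro mult_left_mono L2_set_triangle_ineq) auto
  also have "\<dots> \<le> B + C"
    using grid_boundedD[OF assms(2) F] grid_boundedD[OF assms(3) F] by (simp add: algebra_simps)
  finally show "sqrt h * L2_set (\<lambda>j. v j + w j) F \<le> B + C" .
qed

lemma grid_bounded_mult:
  assumes "0 < h" "grid_bounded h B v" "\<And>j. \<bar>g j\<bar> \<le> L"
  shows "grid_bounded h (L * B) (\<lambda>j. g j * v j)"
  unfolding grid_bounded_def
proof (intro allI impI)
  fix F :: "int set" assume F: "finite F"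
  have L: "0 \<le> L" using assms(3)[of 0] by linarith
  have "L2_set (\<lambda>j. g j * v j) F = L2_set (\<lambda>j. \<bar>g j\<bar> * \<bar>v j\<bar>) F"
    by (simp add: L2_set_def power_mult_distrib)
  also have "\<dots> \<le> L2_set (\<lambda>j. L * \<bar>v j\<bar>) F"
    using assms(3) by (intro L2_set_mono mult_right_mono) auto
  also have "\<dots> = L * L2_set v F"
    using L by (simp add: L2_set_def power_mult_distrib sum_distrib_left[symmetric] real_sqrt_mult)
  finally have "sqrt h * L2_set (\<lambda>j. g j * v j) F \<le> sqrt h * (L * L2_set v F)"
    using assms(1) by (intro mult_left_mono) auto
  also have "\<dots> = L * (sqrt h * L2_set v F)" by simp
  also have "\<dots> \<le> L * B"
    using grid_boundedD[OF assms(2) F] L by (rule mult_left_mono)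
  finally show "sqrt h * L2_set (\<lambda>j. g j * v j) F \<le> L * B" .
qed

lemma grid_bounded_cmult:
  assumes "0 < h" "grid_bounded h B v"
  shows "grid_bounded h (\<bar>c\<bar> * B) (\<lambda>j. c * v j)"
  using grid_bounded_mult[OF assms, of "\<lambda>_. c"] by simp

lemma grid_bounded_diff:
  assumes "0 < h" "grid_bounded h B v" "grid_bounded h C w"
  shows "grid_bounded h (B + C) (\<lambda>j. v j - w j)"
  using grid_bounded_add[OF assms(1,2) grid_bounded_cmult[OF assms(1,3), of "-1"]] by simp

lemma grid_bounded_shift:
  assumes "grid_bounded h B v"
  shows "grid_bounded h B (\<lambda>j. v (j + i))"
  unfolding grid_bounded_def
proof (intro allI impI)
  fix F :: "int set" assume F: "finite F"
  have "L2_set (\<lambda>j. v (j + i)) F = L2_set v ((\<lambda>j. j + i) ` F)"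
    unfolding L2_set_def by (subst sum.reindex) auto
  then show "sqrt h * L2_set (\<lambda>j. v (j + i)) F \<le> B"
    using grid_boundedD[OF assms, of "(\<lambda>j. j + i) ` F"] F by simp
qed

lemma grid_bounded_iff:
  assumes "0 < h"
  shows "grid_bounded h B v \<longleftrightarrow> ell2 v \<and> grid_norm h v \<le> B"
proof
  assume v: "grid_bounded h B v"
  have B: "0 \<le> B" by (rule grid_bounded_nonneg[OF v])
  have le: "(\<Sum>j\<in>F. (v j)\<^sup>2) \<le> B\<^sup>2 / h" if F: "finite F" for F
  proof -
    have "(sqrt h * L2_set v F)\<^sup>2 \<le> B\<^sup>2"
      using grid_boundedD[OF v F] assms by (intro power_mono) auto
    then have "h * (\<Sum>j\<in>F. (v j)\<^sup>2) \<le> B\<^sup>2"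
      using assms by (simp add: L2_set_def power_mult_distrib sum_nonneg)
    then show ?thesis using assms by (simp add: field_simps)
  qed
  have e: "ell2 v"
    unfolding ell2_def
    by (rule nonneg_bdd_above_summable_on) (auto simp: bdd_above_def intro!: le)
  have "(\<Sum>\<^sub>\<infinity>j. (v j)\<^sup>2) \<le> B\<^sup>2 / h"
    using e le unfolding ell2_def by (intro infsum_le_finite_sums) auto
  then have "h * (\<Sum>\<^sub>\<infinity>j. (v j)\<^sup>2) \<le> B\<^sup>2"
    using assms by (simp add: field_simps)
  then show "ell2 v \<and> grid_norm h v \<le> B"
    unfolding grid_norm_def using e B by (auto intro: real_le_lsqrt)
next
  assume v: "ell2 v \<and> grid_norm h v \<le> B"
  show "grid_bounded h B v"
    unfolding grid_bounded_def
  proof (intro allI impI)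
    fix F :: "int set" assume F: "finite F"
    have "(\<Sum>j\<in>F. (v j)\<^sup>2) \<le> (\<Sum>\<^sub>\<infinity>j. (v j)\<^sup>2)"
      using v F unfolding ell2_def by (intro finite_sum_le_infsum) auto
    then have "sqrt (h * (\<Sum>j\<in>F. (v j)\<^sup>2)) \<le> grid_norm h v"
      unfolding grid_norm_def using assms by simp
    then show "sqrt h * L2_set v F \<le> B"
      using v by (simp add: L2_set_def real_sqrt_mult)
  qed
qed

lemma grid_bounded_grid_norm: "0 < h \<Longrightarrow> ell2 v \<Longrightarrow> grid_bounded h (grid_norm h v) v"
  by (simp add: grid_bounded_iff)

lemma grid_bounded_ell2: "0 < h \<Longrightarrow> grid_bounded h B v \<Longrightarrow> ell2 v"
  by (simp add: grid_bounded_iff)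

lemma grid_bounded_norm_le: "0 < h \<Longrightarrow> grid_bounded h B v \<Longrightarrow> grid_norm h v \<le> B"
  by (simp add: grid_bounded_iff)

lemma grid_norm_nonneg: "0 < h \<Longrightarrow> 0 \<le> grid_norm h v"
  by (simp add: grid_norm_def infsum_nonneg)

lemma ell2_add: "ell2 v \<Longrightarrow> ell2 w \<Longrightarrow> ell2 (\<lambda>j. v j + w j)"
  by (rule grid_bounded_ell2[OF zero_less_one], rule grid_bounded_add[OF zero_less_one]) (rule grid_bounded_grid_norm[OF zero_less_one], assumption)+

lemma ell2_mult: "ell2 v \<Longrightarrow> (\<And>j. \<bar>g j\<bar> \<le> L) \<Longrightarrow> ell2 (\<lambda>j. g j * v j)"
  by (rule grid_bounded_ell2[OF zero_less_one], rule grid_bounded_mult[OF zero_less_one grid_bounded_grid_norm[OF zero_less_one]])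

lemma ell2_cmult: "ell2 v \<Longrightarrow> ell2 (\<lambda>j. c * v j)"
  using ell2_mult[of v "\<lambda>_. c" "\<bar>c\<bar>"] by simp

lemma ell2_diff: "ell2 v \<Longrightarrow> ell2 w \<Longrightarrow> ell2 (\<lambda>j. v j - w j)"
  using ell2_add[of v "\<lambda>j. -1 * w j"] ell2_cmult[of w "-1"] by simp

lemma ell2_divide: "ell2 v \<Longrightarrow> ell2 (\<lambda>j. v j / c)"
  using ell2_cmult[of v "1/c"] by simp

lemma ell2_shift: "ell2 v \<Longrightarrow> ell2 (\<lambda>j. v (j + i))"
  by (rule grid_bounded_ell2[OF zero_less_one], rule grid_bounded_shift[OF grid_bounded_grid_norm[OF zero_less_one]])

lemma ell2_shift_minus: "ell2 v \<Longrightarrow> ell2 (\<lambda>j. v (j - i))"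
  using ell2_shift[of v "-i"] by simp

lemma ell2_imp_bounded:
  assumes "ell2 v" obtains L where "\<And>j. \<bar>v j\<bar> \<le> L"
proof
  fix j
  have "sqrt 1 * L2_set v {j} \<le> grid_norm 1 v"
    using assms by (intro grid_boundedD grid_bounded_grid_norm) auto
  then show "\<bar>v j\<bar> \<le> grid_norm 1 v" by (simp add: L2_set_def)
qed

lemma ell2_prod: "ell2 v \<Longrightarrow> ell2 w \<Longrightarrow> ell2 (\<lambda>j. v j * w j)"
  by (rule ell2_imp_bounded[of v]) (auto intro: ell2_mult)

lemmas ell2_intros = ell2_add ell2_diff ell2_cmult ell2_divide ell2_shift ell2_shift_minus ell2_prod

text \<open>
  The Cauchy--Schwarz inequality, with the weight \<open>h\<close> of the grid norm.
\<close>

lemma ell2_mult_abs_summable: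
  assumes "0 < h" "ell2 v" "ell2 w"
  shows "(\<lambda>j. \<bar>v j * w j\<bar>) summable_on UNIV"
    and "h * (\<Sum>\<^sub>\<infinity>j. \<bar>v j * w j\<bar>) \<le> grid_norm h v * grid_norm h w"
proof -
  let ?P = "grid_norm h v * grid_norm h w"
  have le: "(\<Sum>j\<in>F. \<bar>v j * w j\<bar>) \<le> ?P / h" if F: "finite F" for F
  proof -
    have "h * (\<Sum>j\<in>F. \<bar>v j * w j\<bar>) \<le> h * (L2_set v F * L2_set w F)"
      using assms(1) L2_set_mult_ineq[of v w F] by (simp add: abs_mult)
    also have "\<dots> = (sqrt h * L2_set v F) * (sqrt h * L2_set w F)"
      using assms(1) by (simp add: algebra_simps)
    also have "\<dots> \<le> ?P"
      using assms F grid_boundedD[of h "grid_norm h v" v F] grid_boundedD[of h "grid_norm h w" w F]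
      by (intro mult_mono) (auto simp: grid_bounded_grid_norm grid_norm_nonneg)
    finally show ?thesis using assms(1) by (simp add: field_simps)
  qed
  show s: "(\<lambda>j. \<bar>v j * w j\<bar>) summable_on UNIV"
    by (rule nonneg_bdd_above_summable_on) (auto simp: bdd_above_def intro!: le)
  have "(\<Sum>\<^sub>\<infinity>j. \<bar>v j * w j\<bar>) \<le> ?P / h"
    using s le by (intro infsum_le_finite_sums) auto
  then show "h * (\<Sum>\<^sub>\<infinity>j. \<bar>v j * w j\<bar>) \<le> ?P"
    using assms(1) by (simp add: field_simps)
qed

lemma ell2_mult_summable:
  assumes "ell2 v" "ell2 w"
  shows "(\<lambda>j. v j * w j) summable_on UNIV"
proof (rule abs_summable_summable)
  show "(\<lambda>j. norm (v j * w j)) summable_on UNIV"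
    using ell2_mult_abs_summable(1)[OF zero_less_one assms] by (simp only: real_norm_def)
qed

lemma summable_on_diff_real:
  fixes f g :: "'a \<Rightarrow> real"
  assumes "f summable_on A" "g summable_on A"
  shows "(\<lambda>x. f x - g x) summable_on A"
    and "infsum (\<lambda>x. f x - g x) A = infsum f A - infsum g A"
  using summable_on_add[of f A "\<lambda>x. - g x"] infsum_add[of f A "\<lambda>x. - g x"] assms
  by (simp_all add: summable_on_uminus infsum_uminus)

text \<open>
  Summation by parts on the whole grid: the boundary terms at infinity vanish because the sum is
  invariant under shifts.
\<close>

lemma infsum_telescope:
  fixes Q :: "int \<Rightarrow> real"
  assumes "Q summable_on UNIV"
  shows "(\<lambda>j. Q j - Q (j - 1)) summable_on UNIV" "(\<Sum>\<^sub>\<infinity>j. Q j - Q (j - 1)) = 0"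
proof -
  have b: "bij_betw (\<lambda>j::int. j - 1) UNIV UNIV"
    by (rule bij_betwI[of _ _ _ "\<lambda>j. j + 1"]) auto
  have s: "(\<lambda>j. Q (j - 1)) summable_on UNIV"
    using summable_on_reindex_bij_betw[OF b, of Q] assms by simp
  show "(\<lambda>j. Q j - Q (j - 1)) summable_on UNIV"
    using assms s by (rule summable_on_diff_real)
  show "(\<Sum>\<^sub>\<infinity>j. Q j - Q (j - 1)) = 0"
    using infsum_reindex_bij_betw[OF b, of Q] assms s by (simp add: summable_on_diff_real(2))
qed

section \<open>Discrete energy estimates\<close>

text \<open>
  The dispersive operator of the scheme, a second-order approximation of the third derivative
  (\<open>dispersion_error\<close>). Its stencil in \<open>dispersion_eq\<close> is antisymmetric around the node.
\<close>

definition dispersion :: "real \<Rightarrow> (int \<Rightarrow> real) \<Rightarrow> int \<Rightarrow> real" where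
  "dispersion h v = Dminus h (Dcentral h (Dplus h v))"

lemma Dcentral_eq: "Dcentral h v j = (v (j + 1) - v (j - 1)) / (2 * h)"
  by (simp add: Dcentral_def Dplus_def Dminus_def field_simps add_divide_distrib[symmetric] diff_divide_distrib[symmetric])

lemma dispersion_eq:
  "dispersion h v j = (v (j + 2) - 2 * v (j + 1) + 2 * v (j - 1) - v (j - 2)) / (2 * h^3)"
proof -
  have "j - 1 + 2 = j + 1" "j - 1 - 1 = j - 2" "j - 1 + 1 = j" "j + 1 - 1 = j" "j + 1 + 1 = j + 2" by auto
  then have "dispersion h v j = ((v (j + 2) - v (j + 1) - (v j - v (j - 1))) / h / (2 * h)
     - (v (j + 1) - v j - (v (j - 1) - v (j - 2))) / h / (2 * h)) / h"
    by (simp add: dispersion_def Dminus_def Dcentral_eq Dplus_def diff_divide_distrib add.commute)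
  also have "\<dots> = (v (j + 2) - 2 * v (j + 1) + 2 * v (j - 1) - v (j - 2)) / (2 * h^3)"
    by (simp add: diff_divide_distrib[symmetric] power3_eq_cube algebra_simps)
  finally show ?thesis .
qed

lemma grid_avg_add: "grid_avg (\<lambda>j. v j + w j) j = grid_avg v j + grid_avg w j"
  by (simp add: grid_avg_def add_divide_distrib)

lemma Dcentral_add: "Dcentral h (\<lambda>j. v j + w j) j = Dcentral h v j + Dcentral h w j"
  by (simp add: Dcentral_eq add_divide_distrib[symmetric])

lemma dispersion_add: "dispersion h (\<lambda>j. v j + w j) j = dispersion h v j + dispersion h w j"
  by (simp add: dispersion_eq add_divide_distrib[symmetric])

text \<open>
  The cancellations behind stability, before summation. In the flux \<open>Q\<close>, the terms with \<open>h^3\<close> show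
  that the dispersive operator is skew-symmetric; the cubic term comes from
  \<open>E\<^sub>j (E\<^sub>j\<^sub>+\<^sub>1 + E\<^sub>j + E\<^sub>j\<^sub>-\<^sub>1) (E\<^sub>j\<^sub>+\<^sub>1 - E\<^sub>j\<^sub>-\<^sub>1) = a\<^sub>j - a\<^sub>j\<^sub>-\<^sub>1\<close> with
  \<open>a\<^sub>j = E\<^sub>j E\<^sub>j\<^sub>+\<^sub>1 (E\<^sub>j + E\<^sub>j\<^sub>+\<^sub>1)\<close>; and the term with \<open>W\<close> moves the difference quotient in
  \<open>avg W \<cdot> D E\<close> from \<open>E\<close> to \<open>avg W\<close>. What is left contains no difference of \<open>E\<close>, so for
  Lipschitz \<open>W\<close> it is bounded by the norm of \<open>E\<close> uniformly in \<open>h\<close>.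
\<close>

lemma energy_identity:
  fixes h :: real and E W :: "int \<Rightarrow> real"
  defines "Q \<equiv> \<lambda>j. E j * (E (j + 1) / h^3 - E (j + 2) / (2 * h^3)
      - E (j + 1) * (E j + E (j + 1)) / (6 * h) - E (j + 1) * grid_avg W (j + 1) / (2 * h))
      - E (j - 1) * (E (j + 1) / (2 * h^3))"
  shows "E j * (- grid_avg E j * Dcentral h E j - grid_avg W j * Dcentral h E j
      - grid_avg E j * Dcentral h W j - dispersion h E j)
    = Q j - Q (j - 1) + (E j * E (j + 1) * (grid_avg W (j + 1) - grid_avg W j) / (2 * h)
      - E j * grid_avg E j * Dcentral h W j)"
proof -
  \<comment> \<open>With the reciprocals as atoms the claim is a polynomial identity.\<close>
  define a b where "a = 1 / (6 * h)" and "b = 1 / (2 * h ^ 3)"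
  have ab: "x / (6 * h) = x * a" "x / (2 * h) = 3 * x * a" "x / (2 * h ^ 3) = x * b" "x / h ^ 3 = 2 * x * b" for x
    by (simp_all add: a_def b_def)
  have *: "j - 1 + 2 = j + 1" "j - 1 - 1 = j - 2" "j - 1 + 1 = j" by auto
  define y z where "y = grid_avg W (j + 1)" and "z = grid_avg W j"
  have g: "grid_avg E j = (E (j + 1) + E j + E (j - 1)) / 3" by (simp add: grid_avg_def)
  show ?thesis
    unfolding Q_def Dcentral_eq dispersion_eq * ab y_def[symmetric] z_def[symmetric] g
    by (simp add: algebra_simps add_divide_distrib)
qed

lemma grid_norm_half_le:
  assumes "0 < h" "ell2 a" "ell2 b"
  shows "grid_norm h (\<lambda>j. (a j + b j) / 2) \<le> (grid_norm h a + grid_norm h b) / 2"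
proof -
  have "grid_bounded h (\<bar>1/2\<bar> * (grid_norm h a + grid_norm h b)) (\<lambda>j. 1/2 * (a j + b j))"
    using assms by (intro grid_bounded_cmult grid_bounded_add grid_bounded_grid_norm)
  from grid_bounded_norm_le[OF assms(1) this] show ?thesis by simp
qed

lemma grid_bounded_avg:
  assumes "0 < h" "grid_bounded h B v"
  shows "grid_bounded h B (grid_avg v)"
proof -
  have "grid_bounded h (\<bar>1/3\<bar> * (B + B + B)) (\<lambda>j. 1/3 * (v (j + 1) + v j + v (j + -1)))"
    by (intro grid_bounded_cmult grid_bounded_add assms grid_bounded_shift)
  then show ?thesis by (simp add: grid_avg_def[abs_def])
qed

lemma ell2_avg: "ell2 v \<Longrightarrow> ell2 (grid_avg v)"
  by (rule grid_bounded_ell2[OF zero_less_one], rule grid_bounded_avg[OF zero_less_one grid_bounded_grid_norm[OF zero_less_one]])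

lemma grid_norm_avg_le: "0 < h \<Longrightarrow> ell2 v \<Longrightarrow> grid_norm h (grid_avg v) \<le> grid_norm h v"
  by (intro grid_bounded_norm_le grid_bounded_avg grid_bounded_grid_norm)

text \<open>
  Summing \<open>energy_identity\<close> removes the flux. The two remaining terms contribute \<open>L / 2\<close> and \<open>L\<close>
  because a Lipschitz bound on \<open>W\<close> passes to its average and bounds its difference quotient.
\<close>

lemma energy_inequality:
  assumes h: "0 < h" and E: "ell2 E" and W: "ell2 W" and \<tau>: "ell2 \<tau>"
    and lip: "\<And>j. \<bar>W (j + 1) - W j\<bar> \<le> L * h"
  defines "R \<equiv> \<lambda>j. - grid_avg E j * Dcentral h E j - grid_avg W j * Dcentral h E j
      - grid_avg E j * Dcentral h W j - dispersion h E j + \<tau> j"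
  shows "h * (\<Sum>\<^sub>\<infinity>j. E j * R j)
    \<le> 3/2 * L * (grid_norm h E)\<^sup>2 + grid_norm h E * grid_norm h \<tau>"
proof -
  define Q where "Q = (\<lambda>j. E j * (E (j + 1) / h^3 - E (j + 2) / (2 * h^3)
      - E (j + 1) * (E j + E (j + 1)) / (6 * h) - E (j + 1) * grid_avg W (j + 1) / (2 * h))
      - E (j - 1) * (E (j + 1) / (2 * h^3)))"
  define G where "G = (\<lambda>j. E j * E (j + 1) * (grid_avg W (j + 1) - grid_avg W j) / (2 * h)
      - E j * grid_avg E j * Dcentral h W j + E j * \<tau> j)"
  define H where "H = (\<lambda>j. L / 2 * \<bar>E j * E (j + 1)\<bar> + L * \<bar>E j * grid_avg E j\<bar> + \<bar>E j * \<tau> j\<bar>)"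
  have L: "0 \<le> L" using lip[of 0] h zero_le_mult_iff[of L h] by linarith
  have ER: "E j * R j = (Q j - Q (j - 1)) + G j" for j
    using energy_identity[of E j h W] unfolding Q_def G_def R_def by (simp add: algebra_simps)
  have Q: "Q summable_on UNIV"
    unfolding Q_def by (intro summable_on_diff_real(1) ell2_mult_summable ell2_intros E W ell2_avg
        ell2_shift[of "grid_avg W"])
  have avg_lip: "\<bar>grid_avg W (j + 1) - grid_avg W j\<bar> \<le> L * h" for j
    using lip[of "j + 1"] lip[of j] lip[of "j - 1"] by (auto simp: grid_avg_def abs_le_iff field_simps)
  have DW: "\<bar>Dcentral h W j\<bar> \<le> L" for j
    using lip[of j] lip[of "j - 1"] h unfolding Dcentral_eq by (auto simp: abs_le_iff field_simps)
  have GH: "\<bar>G j\<bar> \<le> H j" for j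
  proof -
    have "\<bar>E j * E (j + 1) * (grid_avg W (j + 1) - grid_avg W j) / (2 * h)\<bar>
        = \<bar>E j * E (j + 1)\<bar> * (\<bar>grid_avg W (j + 1) - grid_avg W j\<bar> / (2 * h))"
      using h by (simp add: abs_mult)
    also have "\<dots> \<le> \<bar>E j * E (j + 1)\<bar> * (L / 2)"
      using avg_lip[of j] h by (intro mult_left_mono) (auto simp: field_simps)
    finally have 1: "\<bar>E j * E (j + 1) * (grid_avg W (j + 1) - grid_avg W j) / (2 * h)\<bar>
        \<le> L / 2 * \<bar>E j * E (j + 1)\<bar>" by (simp only: mult.commute)
    have "\<bar>E j * grid_avg E j\<bar> * \<bar>Dcentral h W j\<bar> \<le> \<bar>E j * grid_avg E j\<bar> * L"
      using DW[of j] by (intro mult_left_mono) auto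
    then have 2: "\<bar>E j * grid_avg E j * Dcentral h W j\<bar> \<le> L * \<bar>E j * grid_avg E j\<bar>"
      by (simp only: abs_mult mult.commute)
    show ?thesis unfolding G_def H_def using 1 2 by linarith
  qed
  note s1 = ell2_mult_abs_summable[OF h E ell2_shift[OF E, of 1]]
  note s2 = ell2_mult_abs_summable[OF h E ell2_avg[OF E]]
  note s3 = ell2_mult_abs_summable[OF h E \<tau>]
  note c1 = summable_on_cmult_right[OF s1(1), of "L / 2"]
  note c2 = summable_on_cmult_right[OF s2(1), of L]
  have H: "H summable_on UNIV"
    unfolding H_def by (intro summable_on_add c1 c2 s3)
  have G: "G summable_on UNIV"
    by (rule abs_summable_summable, rule summable_on_comparison_test[OF H]) (use GH in auto)
  have nE: "grid_norm h (\<lambda>j. E (j + 1)) \<le> grid_norm h E"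
    using E h by (intro grid_bounded_norm_le grid_bounded_shift grid_bounded_grid_norm)
  have n0: "0 \<le> grid_norm h E" using h by (rule grid_norm_nonneg)
  have "(\<Sum>\<^sub>\<infinity>j. E j * R j) = (\<Sum>\<^sub>\<infinity>j. G j)"
    unfolding ER using infsum_telescope[OF Q] G by (subst infsum_add) auto
  also have "\<dots> \<le> (\<Sum>\<^sub>\<infinity>j. H j)"
    using G H GH by (intro infsum_mono) (auto simp: abs_le_iff)
  also have "\<dots> = L / 2 * (\<Sum>\<^sub>\<infinity>j. \<bar>E j * E (j + 1)\<bar>) + L * (\<Sum>\<^sub>\<infinity>j. \<bar>E j * grid_avg E j\<bar>)
     + (\<Sum>\<^sub>\<infinity>j. \<bar>E j * \<tau> j\<bar>)"
    unfolding H_def infsum_add[OF summable_on_add[OF c1 c2] s3(1)] infsum_add[OF c1 c2]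
    by (simp only: infsum_cmult_right')
  finally have "h * (\<Sum>\<^sub>\<infinity>j. E j * R j) \<le> h * \<dots>"
    using h by (intro mult_left_mono) auto
  also have "\<dots> = L / 2 * (h * (\<Sum>\<^sub>\<infinity>j. \<bar>E j * E (j + 1)\<bar>))
     + L * (h * (\<Sum>\<^sub>\<infinity>j. \<bar>E j * grid_avg E j\<bar>)) + h * (\<Sum>\<^sub>\<infinity>j. \<bar>E j * \<tau> j\<bar>)"
    by (simp add: algebra_simps)
  also have "\<dots> \<le> L / 2 * (grid_norm h E * grid_norm h E) + L * (grid_norm h E * grid_norm h E)
      + grid_norm h E * grid_norm h \<tau>"
    using s1(2) s2(2) s3(2) mult_left_mono[OF nE n0] mult_left_mono[OF grid_norm_avg_le[OF h E] n0] L
    by (intro add_mono mult_left_mono) auto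
  finally show ?thesis by (simp add: power2_eq_square algebra_simps)
qed

text \<open>
  One step of the error recursion between the levels \<open>a\<close> and \<open>b\<close>. Since \<open>E\<close> is their mean,
  \<open>b\<^sup>2 - a\<^sup>2 = (b - a) \<cdot> 2 E\<close> turns the step into the inner product bounded by
  \<open>energy_inequality\<close>. Cancelling the sum of the two norms afterwards gives a recursion that is
  linear in the norms.
\<close>

lemma energy_step:
  assumes h: "0 < h" and k: "0 < k" and ab: "ell2 a" "ell2 b" and W: "ell2 W" and \<tau>: "ell2 \<tau>"
    and lip: "\<And>j. \<bar>W (j + 1) - W j\<bar> \<le> L * h"
    and E: "E = (\<lambda>j. (a j + b j) / 2)"
    and step: "\<And>j. b j = a j + k * (- grid_avg E j * Dcentral h E j - grid_avg W j * Dcentral h E j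
      - grid_avg E j * Dcentral h W j - dispersion h E j + \<tau> j)"
  shows "grid_norm h b - grid_norm h a
    \<le> k * (3/4 * L * (grid_norm h a + grid_norm h b) + grid_norm h \<tau>)"
proof -
  define s where "s = grid_norm h a + grid_norm h b"
  define R where "R = (\<lambda>j. - grid_avg E j * Dcentral h E j - grid_avg W j * Dcentral h E j
      - grid_avg E j * Dcentral h W j - dispersion h E j + \<tau> j)"
  have L: "0 \<le> L" using lip[of 0] h zero_le_mult_iff[of L h] by linarith
  have E2: "ell2 E" unfolding E by (intro ell2_intros ab)
  have nE: "grid_norm h E \<le> s / 2" unfolding E s_def by (rule grid_norm_half_le[OF h ab])
  have pos: "0 \<le> grid_norm h a" "0 \<le> grid_norm h b" "0 \<le> grid_norm h E" "0 \<le> grid_norm h \<tau>"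
    using h by (simp_all add: grid_norm_nonneg)
  have sq: "(grid_norm h v)\<^sup>2 = h * (\<Sum>\<^sub>\<infinity>j. (v j)\<^sup>2)" for v
    using h by (simp add: grid_norm_def infsum_nonneg)
  have eq: "(b j)\<^sup>2 - (a j)\<^sup>2 = 2 * k * (E j * R j)" for j
  proof -
    have "b j - a j = k * R j" "b j + a j = 2 * E j" using step[of j] unfolding R_def by (auto simp: E)
    then have "(b j - a j) * (b j + a j) = k * R j * (2 * E j)" by simp
    then show ?thesis by (simp add: power2_eq_square algebra_simps)
  qed
  have "(grid_norm h b)\<^sup>2 - (grid_norm h a)\<^sup>2 = h * (\<Sum>\<^sub>\<infinity>j. (b j)\<^sup>2 - (a j)\<^sup>2)"
    unfolding sq using ab by (subst summable_on_diff_real(2)) (auto simp: ell2_def algebra_simps)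
  also have "\<dots> = 2 * k * (h * (\<Sum>\<^sub>\<infinity>j. E j * R j))"
    unfolding eq by (subst infsum_cmult_right') simp
  also have "\<dots> \<le> 2 * k * (3/2 * L * (grid_norm h E)\<^sup>2 + grid_norm h E * grid_norm h \<tau>)"
    unfolding R_def using k energy_inequality[OF h E2 W \<tau> lip] by (intro mult_left_mono) auto
  also have "\<dots> \<le> 2 * k * (3/2 * L * (s / 2)\<^sup>2 + s / 2 * grid_norm h \<tau>)"
    using k L pos nE by (intro mult_left_mono add_mono mult_right_mono power_mono) auto
  also have "\<dots> = k * (3/4 * L * s + grid_norm h \<tau>) * s"
    by (simp add: power2_eq_square field_simps)
  also have "(grid_norm h b)\<^sup>2 - (grid_norm h a)\<^sup>2 = (grid_norm h b - grid_norm h a) * s"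
    by (simp add: s_def power2_eq_square algebra_simps)
  finally have *: "(grid_norm h b - grid_norm h a) * s \<le> k * (3/4 * L * s + grid_norm h \<tau>) * s" .
  show ?thesis
  proof (cases "s = 0")
    case True
    then have "grid_norm h a = 0" "grid_norm h b = 0" using pos unfolding s_def by auto
    then show ?thesis using k pos by simp
  next
    case False
    then have "0 < s" using pos unfolding s_def by auto
    with * show ?thesis unfolding s_def by (simp add: mult_le_cancel_right)
  qed
qed

text \<open>
  The case of a vanishing comparison function. On coarse meshes this bounds the error through the
  triangle inequality.
\<close>

lemma scheme_norm_le:
  assumes h: "0 < h" and k: "0 < k" and U: "kdv_scheme h k u0 U"
  shows "grid_norm h (U n) \<le> grid_norm h (U 0)"
proof (induction n)
  case (Suc n)
  have z: "ell2 (\<lambda>_. 0)" by (simp add: ell2_def)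
  have U': "ell2 (U n)" "ell2 (U (Suc n))" using U by (auto simp: kdv_scheme_def)
  have "grid_norm h (U (Suc n)) - grid_norm h (U n) \<le> k * (3/4 * 0 * (grid_norm h (U n) + grid_norm h (U (Suc n))) + grid_norm h (\<lambda>_. 0))"
  proof (rule energy_step[OF h k U' z z _ refl])
    have e: "half_step U n = (\<lambda>j. (U n j + U (Suc n) j) / 2)" by (simp add: fun_eq_iff half_step_def)
    fix j
    have *: "U (Suc n) j = U n j
        - k * grid_avg (half_step U n) j * Dcentral h (half_step U n) j
        - k * dispersion h (half_step U n) j" using U by (auto simp: kdv_scheme_def dispersion_def)
    show "U (Suc n) j = U n j + k * (- grid_avg (\<lambda>j. (U n j + U (Suc n) j) / 2) j * Dcentral h (\<lambda>j. (U n j + U (Suc n) j) / 2) j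
      - grid_avg (\<lambda>_. 0) j * Dcentral h (\<lambda>j. (U n j + U (Suc n) j) / 2) j
      - grid_avg (\<lambda>j. (U n j + U (Suc n) j) / 2) j * Dcentral h (\<lambda>_. 0) j - dispersion h (\<lambda>j. (U n j + U (Suc n) j) / 2) j + 0)"
    proof -
      have "grid_avg (\<lambda>_. 0) j = 0" "Dcentral h (\<lambda>_. 0) j = 0" by (simp_all add: grid_avg_def Dcentral_eq)
      with * show ?thesis unfolding e[symmetric] by (simp add: algebra_simps)
    qed
  qed auto
  then show ?case using Suc by (simp add: grid_norm_def)
qed simp

text \<open>
  The defect of the pair of levels \<open>v\<close>, \<open>v'\<close> in the scheme, per unit of time. The sign makes it
  appear as a source with positive sign in the recursion for the error.
\<close>

definition truncation_error :: "real \<Rightarrow> real \<Rightarrow> (int \<Rightarrow> real) \<Rightarrow> (int \<Rightarrow> real) \<Rightarrow> int \<Rightarrow> real" where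
  "truncation_error h k v v' j = (let W = \<lambda>j. (v j + v' j) / 2 in
     - ((v' j - v j) / k + grid_avg W j * Dcentral h W j + dispersion h W j))"

text \<open>
  Subtracting the perturbed scheme for \<open>v\<close> from the scheme for \<open>U\<close> and expanding the quadratic
  term around the mean of \<open>v\<close>, \<open>v'\<close> gives a recursion of the form treated in \<open>energy_step\<close>.
\<close>

lemma error_step:
  fixes n :: nat and U :: "nat \<Rightarrow> int \<Rightarrow> real" and v v' :: "int \<Rightarrow> real" and h k L \<tau> :: real
  assumes h: "0 < h" and k: "0 < k" and U: "kdv_scheme h k u0 U"
    and v: "ell2 v" "ell2 v'" and \<tau>: "grid_bounded h \<tau> (truncation_error h k v v')"
    and lip: "\<And>j. \<bar>v (j + 1) - v j\<bar> \<le> L * h" "\<And>j. \<bar>v' (j + 1) - v' j\<bar> \<le> L * h"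
  defines "a \<equiv> grid_norm h (\<lambda>j. U n j - v j)" and "b \<equiv> grid_norm h (\<lambda>j. U (Suc n) j - v' j)"
  shows "b - a \<le> k * (3/4 * L * (a + b) + \<tau>)"
proof -
  define W where "W = (\<lambda>j. (v j + v' j) / 2)"
  define E where "E = (\<lambda>j. ((U n j - v j) + (U (Suc n) j - v' j)) / 2)"
  have U2: "ell2 (U m)" for m using U by (simp add: kdv_scheme_def)
  have \<tau>2: "ell2 (truncation_error h k v v')" by (rule grid_bounded_ell2[OF h \<tau>])
  have half: "half_step U n = (\<lambda>j. W j + E j)"
    by (simp add: fun_eq_iff half_step_def W_def E_def field_simps)
  have "b - a \<le> k * (3/4 * L * (a + b) + grid_norm h (truncation_error h k v v'))"
    unfolding a_def b_def
  proof (rule energy_step[OF h k _ _ _ \<tau>2 _ E_def])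
    show "\<bar>W (j + 1) - W j\<bar> \<le> L * h" for j
      using lip[of j] unfolding W_def by (auto simp: abs_le_iff field_simps)
    fix j
    have t: "(v' j - v j) = - k * (truncation_error h k v v' j + grid_avg W j * Dcentral h W j + dispersion h W j)"
      using k unfolding truncation_error_def Let_def W_def[symmetric] by (simp add: field_simps)
    have "U (Suc n) j = U n j - k * grid_avg (half_step U n) j * Dcentral h (half_step U n) j
        - k * dispersion h (half_step U n) j"
      using U by (auto simp: kdv_scheme_def dispersion_def)
    then have "U (Suc n) j = U n j - k * (grid_avg W j + grid_avg E j) * (Dcentral h W j + Dcentral h E j)
        - k * (dispersion h W j + dispersion h E j)"
      by (simp only: half grid_avg_add Dcentral_add dispersion_add)
    then show "U (Suc n) j - v' j = U n j - v j + k * (- grid_avg E j * Dcentral h E j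
       - grid_avg W j * Dcentral h E j - grid_avg E j * Dcentral h W j - dispersion h E j + truncation_error h k v v' j)"
      using t by (simp add: algebra_simps)
  qed (unfold W_def, (intro ell2_diff ell2_add ell2_divide U2 v)+)
  also have "\<dots> \<le> k * (3/4 * L * (a + b) + \<tau>)"
    using k grid_bounded_norm_le[OF h \<tau>] by (intro mult_left_mono add_left_mono) auto
  finally show ?thesis .
qed

text \<open>
  The recursion is implicit in \<open>e (Suc n)\<close>. For \<open>x = c * k \<le> 1 / 2\<close> it can be solved with
  \<open>(1 + x) / (1 - x) \<le> 1 + 4 * x\<close> and \<open>1 / (1 - x) \<le> 2\<close>, and the explicit recursion is then iterated.
\<close>

lemma discrete_gronwall:
  fixes e :: "nat \<Rightarrow> real"
  assumes e0: "e 0 = 0" and nonneg: "\<And>n. 0 \<le> e n" and k: "0 < k" and c: "0 \<le> c" "c * k \<le> 1 / 2" and \<tau>: "0 \<le> \<tau>"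
    and step: "\<And>n. n < N \<Longrightarrow> e (Suc n) - e n \<le> k * (c * (e n + e (Suc n)) + \<tau>)"
  shows "e N \<le> exp (4 * c * (real N * k)) * (2 * (real N * k) * \<tau>)"
proof -
  define q where "q = 1 + 4 * (c * k)"
  have q: "1 \<le> q" using k c by (simp add: q_def)
  have one: "e (Suc n) \<le> q * e n + 2 * (k * \<tau>)" if "n < N" for n
  proof -
    define x where "x = c * k"
    have x: "0 \<le> x" "x \<le> 1 / 2" using k c by (auto simp: x_def)
    have le: "(1 - x) * e (Suc n) \<le> (1 + x) * e n + k * \<tau>"
      using step[OF that] by (simp add: x_def algebra_simps)
    have "(1 + x) * e n + k * \<tau> \<le> (1 - x) * ((1 + 4 * x) * e n + 2 * (k * \<tau>))"
    proof -
      have "0 \<le> 2 * x * (1 - 2 * x) * e n" using x nonneg by simp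
      moreover have "0 \<le> (1 - 2 * x) * (k * \<tau>)" using x k \<tau> by simp
      ultimately show ?thesis by (simp add: algebra_simps)
    qed
    with le have "(1 - x) * e (Suc n) \<le> (1 - x) * ((1 + 4 * x) * e n + 2 * (k * \<tau>))" by linarith
    then show ?thesis using x unfolding q_def x_def by (simp add: mult_le_cancel_left)
  qed
  have "e n \<le> q ^ n * (2 * (real n * (k * \<tau>)))" if "n \<le> N" for n
    using that
  proof (induction n)
    case (Suc n)
    have "e (Suc n) \<le> q * e n + 2 * (k * \<tau>)" using one Suc by simp
    also have "\<dots> \<le> q * (q ^ n * (2 * (real n * (k * \<tau>)))) + q ^ Suc n * (2 * (k * \<tau>))"
    proof (intro add_mono mult_left_mono)
      show "2 * (k * \<tau>) \<le> q ^ Suc n * (2 * (k * \<tau>))"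
        using mult_right_mono[OF one_le_power[OF q, of "Suc n"], of "2 * (k * \<tau>)"] k \<tau> by simp
    qed (use Suc q in auto)
    also have "\<dots> = q ^ Suc n * (2 * (real (Suc n) * (k * \<tau>)))" by (simp add: algebra_simps)
    finally show ?case .
  qed (use e0 in simp)
  from this[of N] have "e N \<le> q ^ N * (2 * (real N * (k * \<tau>)))" by simp
  also have "\<dots> \<le> exp (4 * (c * k)) ^ N * (2 * (real N * (k * \<tau>)))"
    using q k \<tau> exp_ge_add_one_self[of "4 * (c * k)"] unfolding q_def
    by (intro mult_right_mono power_mono) auto
  also have "\<dots> = exp (4 * c * (real N * k)) * (2 * (real N * k) * \<tau>)"
    by (simp add: exp_of_nat_mult[symmetric] algebra_simps)
  finally show ?thesis .
qed

section \<open>Sampling functions of one variable\<close>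

text \<open>
  The function \<open>(z - (a + h)) * (f z)\<^sup>2\<close> vanishes at the right end of the cell and equals
  \<open>- h * (f a)\<^sup>2\<close> at the left end, so the point value is the integral of its derivative. The cell is
  half-open so that the cells of a grid are disjoint.
\<close>

lemma point_value_le_integral:
  fixes f f' :: "real \<Rightarrow> real"
  assumes h: "0 < h" and f: "\<And>x. (f has_real_derivative f' x) (at x)" and f': "continuous_on UNIV f'"
  shows "h * (f a)\<^sup>2 \<le> (LINT z|lborel. indicator {a..<a+h} z * ((1 + h) * (f z)\<^sup>2 + h * (f' z)\<^sup>2))"
proof -
  define q where "q = (\<lambda>z. (f z)\<^sup>2 + (z - (a + h)) * (2 * f z * f' z))"
  define p where "p = (\<lambda>z. (1 + h) * (f z)\<^sup>2 + h * (f' z)\<^sup>2)"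
  have cf: "continuous_on S f" for S
    using f by (meson DERIV_continuous continuous_at_imp_continuous_on)
  have cf': "continuous_on S f'" for S
    using f' continuous_on_subset by blast
  have cq: "continuous_on {a..a+h} q"
    unfolding q_def by (intro continuous_intros cf cf')
  have cp: "continuous_on {a..a+h} p"
    unfolding p_def by (intro continuous_intros cf cf')
  have "h * (f a)\<^sup>2 = (LINT z|lborel. indicator {a..a+h} z *\<^sub>R q z)"
  proof (subst integral_FTC_atLeastAtMost[of a "a + h" "\<lambda>z. (z - (a + h)) * (f z)\<^sup>2"])
    fix x
    have "((\<lambda>z. (z - (a + h)) * (f z)\<^sup>2) has_real_derivative q x) (at x)"
      unfolding q_def by (auto intro!: derivative_eq_intros f simp: power2_eq_square algebra_simps)
    then show "((\<lambda>z. (z - (a + h)) * (f z)\<^sup>2) has_vector_derivative q x) (at x within {a..a + h})"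
      using has_real_derivative_iff_has_vector_derivative has_vector_derivative_at_within by blast
  qed (use h cq in auto)
  also have "\<dots> \<le> (LINT z|lborel. indicator {a..a+h} z *\<^sub>R p z)"
  proof (rule integral_mono)
    show "integrable lborel (\<lambda>z. indicator {a..a + h} z *\<^sub>R q z)"
      using borel_integrable_atLeastAtMost'[OF cq] by (simp add: set_integrable_def)
    show "integrable lborel (\<lambda>z. indicator {a..a + h} z *\<^sub>R p z)"
      using borel_integrable_atLeastAtMost'[OF cp] by (simp add: set_integrable_def)
    fix z
    have "q z \<le> p z" if z: "a \<le> z" "z \<le> a + h"
    proof -
      have "(z - (a + h)) * (2 * f z * f' z) \<le> \<bar>z - (a + h)\<bar> * \<bar>2 * f z * f' z\<bar>"
        by (metis abs_ge_self abs_mult)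
      also have "\<dots> \<le> h * ((f z)\<^sup>2 + (f' z)\<^sup>2)"
      proof (rule mult_mono)
        show "\<bar>2 * f z * f' z\<bar> \<le> (f z)\<^sup>2 + (f' z)\<^sup>2"
          using sum_squares_bound[of "f z" "f' z"] sum_squares_bound[of "f z" "- f' z"] by (auto simp: abs_le_iff)
      qed (use z h in auto)
      finally show ?thesis unfolding q_def p_def by (simp add: algebra_simps)
    qed
    then show "indicator {a..a + h} z *\<^sub>R q z \<le> indicator {a..a + h} z *\<^sub>R p z"
      by (auto split: split_indicator)
  qed
  also have "\<dots> = (LINT z|lborel. indicator {a..<a+h} z * p z)"
  proof (rule integral_cong_AE)
    have "continuous_on UNIV p" unfolding p_def by (intro continuous_intros cf cf')
    then have [measurable]: "p \<in> borel_measurable borel" by (rule borel_measurable_continuous_onI)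
    show "(\<lambda>z. indicator {a..a + h} z *\<^sub>R p z) \<in> borel_measurable lborel" by measurable
    show "(\<lambda>z. indicator {a..<a + h} z * p z) \<in> borel_measurable lborel" by measurable
    show "AE z in lborel. indicator {a..a + h} z *\<^sub>R p z = indicator {a..<a + h} z * p z"
      using AE_lborel_singleton[of "a + h"] by eventually_elim (auto split: split_indicator)
  qed
  finally show ?thesis unfolding p_def .
qed

lemma sum_indicator_cells_le_1:
  fixes h y z :: real
  assumes "0 < h" "finite F"
  shows "(\<Sum>j\<in>F. indicator {of_int j * h + y..<of_int j * h + y + h} z) \<le> (1::real)"
proof -
  have "indicator {of_int j * h + y..<of_int j * h + y + h} z \<le> (if j = \<lfloor>(z - y) / h\<rfloor> then 1 else (0::real))" for j :: int
  proof (cases "z \<in> {of_int j * h + y..<of_int j * h + y + h}")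
    case True
    then have "of_int j \<le> (z - y) / h" "(z - y) / h < of_int j + 1"
      using assms(1) by (auto simp: field_simps)
    then have "\<lfloor>(z - y) / h\<rfloor> = j" by linarith
    then show ?thesis by (simp add: True)
  qed simp
  then have "(\<Sum>j\<in>F. indicator {of_int j * h + y..<of_int j * h + y + h} z)
      \<le> (\<Sum>j\<in>F. if j = \<lfloor>(z - y) / h\<rfloor> then 1 else (0::real))"
    by (intro sum_mono) auto
  also have "\<dots> \<le> 1" using assms(2) by simp
  finally show ?thesis .
qed

text \<open>
  The cell-wise bound is added over the grid. The offset \<open>y\<close> makes the result uniform over all
  translates of the grid; for \<open>h = 1\<close> and a single node it is also a bound of the supremum of \<open>f\<close>.
\<close>

lemma sampling_bound:
  fixes f f' :: "real \<Rightarrow> real"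
  assumes h: "0 < h" and f: "\<And>x. (f has_real_derivative f' x) (at x)" and f': "continuous_on UNIV f'"
    and int: "integrable lborel (\<lambda>x. (f x)\<^sup>2)" "integrable lborel (\<lambda>x. (f' x)\<^sup>2)"
    and M: "(LINT x|lborel. (f x)\<^sup>2) \<le> M" "(LINT x|lborel. (f' x)\<^sup>2) \<le> M"
  shows "grid_bounded h (sqrt M * (1 + h)) (\<lambda>j. f (of_int j * h + y))"
  unfolding grid_bounded_def
proof (intro allI impI)
  fix F :: "int set" assume F: "finite F"
  define p where "p = (\<lambda>z. (1 + h) * (f z)\<^sup>2 + h * (f' z)\<^sup>2)"
  define I where "I = (\<lambda>j::int. {of_int j * h + y..<of_int j * h + y + h})"
  have M0: "0 \<le> M" by (rule order_trans[OF _ M(1)]) simp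
  have p0: "0 \<le> p z" for z using h by (simp add: p_def)
  have ip: "integrable lborel p"
    unfolding p_def by (intro Bochner_Integration.integrable_add integrable_mult_right int)
  have iI: "integrable lborel (\<lambda>z. indicator (I j) z * p z)" for j
    using integrable_mult_indicator[OF _ ip, of "I j"] by (simp add: I_def)
  have "h * (\<Sum>j\<in>F. (f (of_int j * h + y))\<^sup>2) = (\<Sum>j\<in>F. h * (f (of_int j * h + y))\<^sup>2)"
    by (rule sum_distrib_left)
  also have "\<dots> \<le> (\<Sum>j\<in>F. (LINT z|lborel. indicator (I j) z * p z))"
    unfolding I_def p_def by (intro sum_mono point_value_le_integral h f f')
  also have "\<dots> = (LINT z|lborel. (\<Sum>j\<in>F. indicator (I j) z * p z))"
    using iI by (subst Bochner_Integration.integral_sum) auto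
  also have "\<dots> \<le> (LINT z|lborel. p z)"
  proof (rule integral_mono)
    show "integrable lborel (\<lambda>z. \<Sum>j\<in>F. indicator (I j) z * p z)"
      using iI by (intro Bochner_Integration.integrable_sum) auto
    fix z
    have "(\<Sum>j\<in>F. indicator (I j) z) * p z \<le> 1 * p z"
      unfolding I_def using sum_indicator_cells_le_1[OF h F] p0 by (intro mult_right_mono) auto
    then show "(\<Sum>j\<in>F. indicator (I j) z * p z) \<le> p z" by (simp add: sum_distrib_right)
  qed (rule ip)
  also have "\<dots> = (1 + h) * (LINT x|lborel. (f x)\<^sup>2) + h * (LINT x|lborel. (f' x)\<^sup>2)"
    unfolding p_def using int by (subst Bochner_Integration.integral_add) auto
  also have "\<dots> \<le> (1 + h) * M + h * M"
    using M h by (intro add_mono mult_left_mono) auto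
  also have "\<dots> \<le> M * (1 + h)\<^sup>2"
    using M0 by (simp add: power2_eq_square algebra_simps)
  finally have "sqrt (h * (\<Sum>j\<in>F. (f (of_int j * h + y))\<^sup>2)) \<le> sqrt (M * (1 + h)\<^sup>2)"
    by (rule real_sqrt_le_mono)
  then show "sqrt h * L2_set (\<lambda>j. f (of_int j * h + y)) F \<le> sqrt M * (1 + h)"
    using h by (simp add: L2_set_def real_sqrt_mult)
qed

section \<open>Consistency of the difference quotients\<close>

text \<open>
  Taylor's theorem in the discrete \<open>L\<^sup>2\<close> norm. By duality: the remainder \<open>r\<close> is tested against
  itself, that is, the scalar Taylor theorem is applied to \<open>\<phi> s = (\<Sum>j\<in>F. r j * d 0 j s)\<close>, whose highest
  derivative is bounded by the Cauchy--Schwarz inequality at each fixed \<open>s\<close>. Cancelling one factor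
  of the norm of \<open>r\<close> leaves the claim. Derivatives relative to \<open>S\<close> allow expansions up to the end
  points of the time interval.
\<close>

lemma grid_taylor:
  fixes d :: "nat \<Rightarrow> int \<Rightarrow> real \<Rightarrow> real"
  assumes h: "0 < h" and S: "convex S"
    and d: "\<And>i j s. s \<in> S \<Longrightarrow> i \<le> n \<Longrightarrow> (d i j has_real_derivative d (Suc i) j s) (at s within S)"
    and B: "\<And>s. s \<in> S \<Longrightarrow> grid_bounded h B (\<lambda>j. d (Suc n) j s)"
    and w: "w \<in> S" and z: "z \<in> S"
  shows "grid_bounded h (B * \<bar>z - w\<bar> ^ Suc n / fact n)
    (\<lambda>j. d 0 j z - (\<Sum>i\<le>n. d i j w * (z - w) ^ i / fact i))"
  unfolding grid_bounded_def
proof (intro allI impI)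
  fix F :: "int set" assume F: "finite F"
  define r where "r = (\<lambda>j. d 0 j z - (\<Sum>i\<le>n. d i j w * (z - w) ^ i / fact i))"
  define \<phi> where "\<phi> = (\<lambda>i s. \<Sum>j\<in>F. r j * d i j s)"
  have bound_nonneg: "0 \<le> B" using grid_bounded_nonneg[OF B[OF w]] .
  have "norm (\<phi> 0 z - (\<Sum>i\<le>n. \<phi> i w * (z - w) ^ i / fact i))
      \<le> (L2_set r F * (B / sqrt h)) * norm (z - w) ^ Suc n / fact n"
  proof (rule field_Taylor[OF S _ _ w z])
    fix i s assume s: "s \<in> S" and "i \<le> n"
    then show "(\<phi> i has_field_derivative \<phi> (Suc i) s) (at s within S)"
      unfolding \<phi>_def by (auto intro!: derivative_eq_intros d sum.cong)
  next
    fix s assume s: "s \<in> S"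
    have "norm (\<phi> (Suc n) s) \<le> (\<Sum>j\<in>F. \<bar>r j\<bar> * \<bar>d (Suc n) j s\<bar>)"
      unfolding \<phi>_def by (rule order_trans[OF norm_sum]) (simp add: abs_mult)
    also have "\<dots> \<le> L2_set r F * L2_set (\<lambda>j. d (Suc n) j s) F"
      by (rule L2_set_mult_ineq)
    also have "\<dots> \<le> L2_set r F * (B / sqrt h)"
      using grid_boundedD[OF B[OF s] F] h by (intro mult_left_mono) (auto simp: field_simps)
    finally show "norm (\<phi> (Suc n) s) \<le> L2_set r F * (B / sqrt h)" .
  qed
  moreover have "\<phi> 0 z - (\<Sum>i\<le>n. \<phi> i w * (z - w) ^ i / fact i) = (\<Sum>j\<in>F. r j * r j)"
  proof -
    have "(\<Sum>i\<le>n. \<phi> i w * (z - w) ^ i / fact i) = (\<Sum>j\<in>F. r j * (\<Sum>i\<le>n. d i j w * (z - w) ^ i / fact i))"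
      unfolding \<phi>_def sum_distrib_right sum_distrib_left sum_divide_distrib
      by (subst sum.swap) (simp add: mult.assoc)
    then show ?thesis
      unfolding \<phi>_def by (simp add: r_def sum_subtractf[symmetric] right_diff_distrib[symmetric] del: sum_subtractf)
  qed
  moreover have "(\<Sum>j\<in>F. r j * r j) = L2_set r F * L2_set r F"
    by (simp add: L2_set_def sum_nonneg power2_eq_square)
  ultimately have *: "L2_set r F * L2_set r F \<le> L2_set r F * (B / sqrt h * \<bar>z - w\<bar> ^ Suc n / fact n)"
    by (simp add: mult.assoc)
  have "L2_set r F \<le> B / sqrt h * \<bar>z - w\<bar> ^ Suc n / fact n"
  proof (cases "L2_set r F = 0")
    case True
    then show ?thesis using bound_nonneg h by simp
  next
    case False
    then have "0 < L2_set r F" using L2_set_nonneg[of r F] by linarith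
    with * show ?thesis by (rule mult_left_le_imp_le)
  qed
  then have "sqrt h * L2_set r F \<le> sqrt h * (B / sqrt h * \<bar>z - w\<bar> ^ Suc n / fact n)"
    using h by (intro mult_left_mono) auto
  then show "sqrt h * L2_set (\<lambda>j. d 0 j z - (\<Sum>i\<le>n. d i j w * (z - w) ^ i / fact i)) F
      \<le> B * \<bar>z - w\<bar> ^ Suc n / fact n"
    unfolding r_def[symmetric] using h by simp
qed

context
  fixes h B :: real and f :: "nat \<Rightarrow> real \<Rightarrow> real" and n :: nat
  assumes h: "0 < h"
    and f: "\<And>i x. i \<le> n \<Longrightarrow> (f i has_real_derivative f (Suc i) x) (at x)"
    and B: "\<And>y. grid_bounded h B (\<lambda>j. f (Suc n) (of_int j * h + y))"
begin

lemma taylor_at_neighbour: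
  "grid_bounded h (B * \<bar>of_int i * h\<bar> ^ Suc n / fact n)
    (\<lambda>j. f 0 (of_int (j + i) * h) - (\<Sum>l\<le>n. f l (of_int j * h) * (of_int i * h) ^ l / fact l))"
proof -
  have "((\<lambda>s. f l (of_int j * h + s)) has_real_derivative f (Suc l) (of_int j * h + s)) (at s within UNIV)"
    if "l \<le> n" for l j s
    using f[OF that, of "of_int j * h + s"] by (simp add: DERIV_shift add.commute)
  from grid_taylor[OF h convex_UNIV this B, where w = 0 and z = "of_int i * h" ]
  show ?thesis by (simp add: algebra_simps)
qed

end

lemma grid_avg_error:
  fixes f :: "nat \<Rightarrow> real \<Rightarrow> real"
  assumes h: "0 < h"
    and f: "\<And>i x. i \<le> 1 \<Longrightarrow> (f i has_real_derivative f (Suc i) x) (at x)"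
    and B: "\<And>y. grid_bounded h B (\<lambda>j. f 2 (of_int j * h + y))"
  shows "grid_bounded h (B * h\<^sup>2) (\<lambda>j. grid_avg (\<lambda>j. f 0 (of_int j * h)) j - f 0 (of_int j * h))"
proof -
  have B': "grid_bounded h B (\<lambda>j. f (Suc 1) (of_int j * h + y))" for y using B by (simp add: numeral_2_eq_2)
  define R where "R = (\<lambda>i j. f 0 (of_int (j + i) * h) - (\<Sum>l\<le>1. f l (of_int j * h) * (of_int i * h) ^ l / fact l))"
  have R: "grid_bounded h (B * \<bar>of_int i * h\<bar> ^ Suc 1 / fact 1) (R i)" for i
    unfolding R_def by (rule taylor_at_neighbour[OF h f B'])
  have "grid_bounded h (\<bar>1/3\<bar> * (B * \<bar>of_int 1 * h\<bar> ^ Suc 1 / fact 1 + B * \<bar>of_int (-1) * h\<bar> ^ Suc 1 / fact 1))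
     (\<lambda>j. 1/3 * (R 1 j + R (-1) j))"
    by (intro grid_bounded_cmult grid_bounded_add h R)
  then show ?thesis
  proof (rule grid_bounded_weaken)
    show "1/3 * (R 1 j + R (-1) j) = grid_avg (\<lambda>j. f 0 (of_int j * h)) j - f 0 (of_int j * h)" for j
    by (simp add: R_def grid_avg_def field_simps)
  qed (use h grid_bounded_nonneg[OF B] in \<open>simp add: power2_eq_square\<close>)
qed

lemma Dcentral_error:
  fixes f :: "nat \<Rightarrow> real \<Rightarrow> real"
  assumes h: "0 < h"
    and f: "\<And>i x. i \<le> 2 \<Longrightarrow> (f i has_real_derivative f (Suc i) x) (at x)"
    and B: "\<And>y. grid_bounded h B (\<lambda>j. f 3 (of_int j * h + y))"
  shows "grid_bounded h (B * h\<^sup>2) (\<lambda>j. Dcentral h (\<lambda>j. f 0 (of_int j * h)) j - f 1 (of_int j * h))"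
proof -
  have B': "grid_bounded h B (\<lambda>j. f (Suc 2) (of_int j * h + y))" for y using B by (simp add: eval_nat_numeral)
  define R where "R = (\<lambda>i j. f 0 (of_int (j + i) * h) - (\<Sum>l\<le>2. f l (of_int j * h) * (of_int i * h) ^ l / fact l))"
  have R: "grid_bounded h (B * \<bar>of_int i * h\<bar> ^ Suc 2 / fact 2) (R i)" for i
    unfolding R_def by (rule taylor_at_neighbour[OF h f B'])
  have "grid_bounded h (\<bar>1/(2*h)\<bar> * (B * \<bar>of_int 1 * h\<bar> ^ Suc 2 / fact 2 + B * \<bar>of_int (-1) * h\<bar> ^ Suc 2 / fact 2))
     (\<lambda>j. 1/(2*h) * (R 1 j - R (-1) j))"
    by (intro grid_bounded_cmult grid_bounded_diff h R)
  then show ?thesis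
  proof (rule grid_bounded_weaken)
    show "1/(2*h) * (R 1 j - R (-1) j) = Dcentral h (\<lambda>j. f 0 (of_int j * h)) j - f 1 (of_int j * h)" for j
    using h by (simp add: R_def Dcentral_eq eval_nat_numeral field_simps)
  qed (use h grid_bounded_nonneg[OF B] in \<open>simp add: eval_nat_numeral field_simps\<close>)
qed

text \<open>
  The weights of the stencil annihilate the even powers and the first power of \<open>h\<close> and reproduce the
  third derivative, so only the fifth-order remainders survive. Divided by \<open>2 * h^3\<close> their sum is
  \<open>(32 + 32 + 2 + 2) / 48 * B * h\<^sup>2\<close>.
\<close>

lemma dispersion_error:
  fixes f :: "nat \<Rightarrow> real \<Rightarrow> real"
  assumes h: "0 < h"
    and f: "\<And>i x. i \<le> 4 \<Longrightarrow> (f i has_real_derivative f (Suc i) x) (at x)"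
    and B: "\<And>y. grid_bounded h B (\<lambda>j. f 5 (of_int j * h + y))"
  shows "grid_bounded h (2 * B * h\<^sup>2) (\<lambda>j. dispersion h (\<lambda>j. f 0 (of_int j * h)) j - f 3 (of_int j * h))"
proof -
  have B': "grid_bounded h B (\<lambda>j. f (Suc 4) (of_int j * h + y))" for y using B by (simp add: eval_nat_numeral)
  define R where "R = (\<lambda>i j. f 0 (of_int (j + i) * h) - (\<Sum>l\<le>4. f l (of_int j * h) * (of_int i * h) ^ l / fact l))"
  have R: "grid_bounded h (B * \<bar>of_int i * h\<bar> ^ Suc 4 / fact 4) (R i)" for i
    unfolding R_def by (rule taylor_at_neighbour[OF h f B'])
  have "grid_bounded h (\<bar>1/(2*h^3)\<bar> * ((B * \<bar>of_int 2 * h\<bar> ^ Suc 4 / fact 4 + B * \<bar>of_int (-2) * h\<bar> ^ Suc 4 / fact 4)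
     + \<bar>2\<bar> * (B * \<bar>of_int 1 * h\<bar> ^ Suc 4 / fact 4 + B * \<bar>of_int (-1) * h\<bar> ^ Suc 4 / fact 4)))
     (\<lambda>j. 1/(2*h^3) * ((R 2 j - R (-2) j) - 2 * (R 1 j - R (-1) j)))"
    by (intro grid_bounded_cmult grid_bounded_diff h R)
  then show ?thesis
  proof (rule grid_bounded_weaken)
    show "1/(2*h^3) * ((R 2 j - R (-2) j) - 2 * (R 1 j - R (-1) j)) = dispersion h (\<lambda>j. f 0 (of_int j * h)) j - f 3 (of_int j * h)" for j
    using h by (simp add: R_def dispersion_eq eval_nat_numeral field_simps)
  qed (use h grid_bounded_nonneg[OF B] in \<open>simp add: eval_nat_numeral field_simps\<close>)
qed

text \<open>
  Expanding around the midpoint cancels the odd terms of the mean and the even terms of the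
  difference, so each of them is accurate to second order.
\<close>

lemma midpoint_errors:
  fixes d :: "nat \<Rightarrow> int \<Rightarrow> real \<Rightarrow> real"
  assumes h: "0 < h" and k: "0 < k" and S: "convex S" "s \<in> S" "s + k \<in> S" "s + k/2 \<in> S"
    and d: "\<And>i j s. s \<in> S \<Longrightarrow> i \<le> n \<Longrightarrow> (d i j has_real_derivative d (Suc i) j s) (at s within S)"
    and B: "\<And>s. s \<in> S \<Longrightarrow> grid_bounded h B (\<lambda>j. d (Suc n) j s)"
  shows "n = 1 \<Longrightarrow> grid_bounded h (B * k\<^sup>2) (\<lambda>j. (d 0 j s + d 0 j (s + k)) / 2 - d 0 j (s + k/2))"
    and "n = 2 \<Longrightarrow> grid_bounded h (B * k\<^sup>2) (\<lambda>j. (d 0 j (s + k) - d 0 j s) / k - d 1 j (s + k/2))"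
proof -
  define R where "R = (\<lambda>z j. d 0 j z - (\<Sum>i\<le>n. d i j (s + k/2) * (z - (s + k/2)) ^ i / fact i))"
  have R: "grid_bounded h (B * \<bar>z - (s + k/2)\<bar> ^ Suc n / fact n) (R z)" if "z \<in> S" for z
    unfolding R_def by (rule grid_taylor[OF h S(1) d B S(4) that])
  have bound_nonneg: "0 \<le> B" using grid_bounded_nonneg[OF B[OF S(2)]] .
  {
    assume n: "n = 1"
    have "grid_bounded h (\<bar>1/2\<bar> * (B * \<bar>s - (s + k/2)\<bar> ^ Suc n / fact n + B * \<bar>s + k - (s + k/2)\<bar> ^ Suc n / fact n))
       (\<lambda>j. 1/2 * (R s j + R (s + k) j))"
      by (intro grid_bounded_cmult grid_bounded_add h R S)
    then show "grid_bounded h (B * k\<^sup>2) (\<lambda>j. (d 0 j s + d 0 j (s + k)) / 2 - d 0 j (s + k/2))"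
    proof (rule grid_bounded_weaken)
      show "1/2 * (R s j + R (s + k) j) = (d 0 j s + d 0 j (s + k)) / 2 - d 0 j (s + k/2)" for j
      by (simp add: R_def n field_simps)
    qed (use k bound_nonneg in \<open>simp add: n power2_eq_square field_simps\<close>)
  }
  {
    assume n: "n = 2"
    have "grid_bounded h (\<bar>1/k\<bar> * (B * \<bar>s + k - (s + k/2)\<bar> ^ Suc n / fact n + B * \<bar>s - (s + k/2)\<bar> ^ Suc n / fact n))
       (\<lambda>j. 1/k * (R (s + k) j - R s j))"
      by (intro grid_bounded_cmult grid_bounded_diff h R S)
    then show "grid_bounded h (B * k\<^sup>2) (\<lambda>j. (d 0 j (s + k) - d 0 j s) / k - d 1 j (s + k/2))"
    proof (rule grid_bounded_weaken)
      show "1/k * (R (s + k) j - R s j) = (d 0 j (s + k) - d 0 j s) / k - d 1 j (s + k/2)" for j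
      using k by (simp add: R_def n eval_nat_numeral field_simps)
    qed (use k bound_nonneg in \<open>simp add: n eval_nat_numeral field_simps\<close>)
  }
qed

section \<open>Convergence for smooth solutions\<close>

text \<open>
  The properties of a smooth solution that the convergence proof uses: \<open>w a b\<close> is the partial
  derivative of order \<open>a\<close> in \<open>x\<close> and \<open>b\<close> in \<open>t\<close>, and \<open>S * (1 + h)\<close> bounds the sampled derivatives up
  to order five. The equation is required at interior times, among
  which are the midpoints of all time steps.
\<close>

locale kdv_strip =
  fixes T S :: real and w :: "nat \<Rightarrow> nat \<Rightarrow> real \<Rightarrow> real \<Rightarrow> real"
  assumes dx: "\<And>a b x t. a + b < 6 \<Longrightarrow> t \<in> {0..T} \<Longrightarrow>
      ((\<lambda>y. w a b y t) has_real_derivative w (Suc a) b x t) (at x)"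
    and dt: "\<And>a b x t. a + b < 6 \<Longrightarrow> t \<in> {0..T} \<Longrightarrow>
      ((\<lambda>s. w a b x s) has_real_derivative w a (Suc b) x t) (at t within {0..T})"
    and sampled_bound: "\<And>a b t h y. a + b < 6 \<Longrightarrow> t \<in> {0..T} \<Longrightarrow> 0 < h \<Longrightarrow>
      grid_bounded h (S * (1 + h)) (\<lambda>j. w a b (of_int j * h + y) t)"
    and pde: "\<And>x t. t \<in> {0<..<T} \<Longrightarrow> w 0 1 x t + w 0 0 x t * w 1 0 x t + w 3 0 x t = 0"
    and T0: "0 < T"
begin

text \<open>
  The common bound of the sampled derivatives on all grids with \<open>h \<le> 1\<close>. The case of a single node
  and \<open>h = 1\<close> shows that it is also a bound of their suprema.
\<close>

abbreviation "B \<equiv> 2 * S"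

lemma sampled_bound_small:
  assumes "a + b < 6" "t \<in> {0..T}" "0 < h" "h \<le> 1"
  shows "grid_bounded h B (\<lambda>j. w a b (of_int j * h + y) t)"
proof (rule grid_bounded_mono[OF sampled_bound[OF assms(1-3)]])
  have "0 \<le> S * (1 + h)" by (rule grid_bounded_nonneg[OF sampled_bound[OF assms(1-3)]])
  then have "0 \<le> S" using assms by (simp add: zero_le_mult_iff)
  then have "S * (1 + h) \<le> S * 2" using assms by (intro mult_left_mono) auto
  then show "S * (1 + h) \<le> B" by simp
qed

lemma sampled_bound_nodes: "a + b < 6 \<Longrightarrow> t \<in> {0..T} \<Longrightarrow> 0 < h \<Longrightarrow> h \<le> 1 \<Longrightarrow> grid_bounded h B (\<lambda>j. w a b (of_int j * h) t)"
  using sampled_bound_small[of a b t h 0] by simp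

lemma sup_bound: "a + b < 6 \<Longrightarrow> t \<in> {0..T} \<Longrightarrow> \<bar>w a b x t\<bar> \<le> B"
  using grid_boundedD[OF sampled_bound_small[of a b t 1 x], of "{0}"] by simp

lemma bound_nonneg: "0 \<le> B"
  using sup_bound[of 0 0 0 0] T0 by force

lemma lipschitz_bound:
  assumes "t \<in> {0..T}"
  shows "\<bar>w 0 0 x t - w 0 0 y t\<bar> \<le> B * \<bar>x - y\<bar>"
  using field_differentiable_bound[of UNIV "\<lambda>y. w 0 0 y t" "\<lambda>y. w 1 0 y t" B x y] dx[of 0 0 t] sup_bound[of 1 0 t] assms
  by simp

text \<open>
  All terms are compared with their values at the midpoint \<open>m\<close> of the time step, where the
  differential equation cancels the leading parts. The product is split as
  \<open>avg W \<cdot> D W - u \<cdot> u\<^sub>x = avg W \<cdot> (D W - u\<^sub>x) + u\<^sub>x \<cdot> (avg W - u)\<close>, where the first factors are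
  bounded in the supremum norm and the second ones in the discrete \<open>L\<^sup>2\<close> norm.
\<close>

lemma truncation_bound:
  assumes h: "0 < h" "h \<le> 1" and k: "0 < k" and s: "0 \<le> s" "s + k \<le> T"
  shows "grid_bounded h ((2 * B + 2 * B\<^sup>2) * (h\<^sup>2 + k\<^sup>2))
    (truncation_error h k (\<lambda>j. w 0 0 (of_int j * h) s) (\<lambda>j. w 0 0 (of_int j * h) (s + k)))"
proof -
  define m where "m = s + k / 2"
  have sT: "s \<in> {0..T}" "s + k \<in> {0..T}" "s + k/2 \<in> {0..T}" using s k by auto
  have mT: "m \<in> {0..T}" "m \<in> {0<..<T}" using s k by (auto simp: m_def)
  define v where "v = (\<lambda>j. w 0 0 (of_int j * h) s)"
  define v' where "v' = (\<lambda>j. w 0 0 (of_int j * h) (s + k))"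
  define W where "W = (\<lambda>j. (v j + v' j) / 2)"
  have W': "W = (\<lambda>j. 1/2 * v j + 1/2 * v' j)" by (simp add: W_def fun_eq_iff field_simps)
  have midpoint: "grid_bounded h (B * k\<^sup>2) (\<lambda>j. (w a 0 (of_int j * h) s + w a 0 (of_int j * h) (s + k)) / 2
      - w a 0 (of_int j * h) m)" if "a < 4" for a
    unfolding m_def
    using midpoint_errors(1)[OF h(1) k convex_closed_interval sT, where n = 1 and B = B and d = "\<lambda>i j. w a i (of_int j * h)"]
      that dt sampled_bound_nodes h by simp
  have P1: "grid_bounded h (B * k\<^sup>2) (\<lambda>j. (v' j - v j) / k - w 0 1 (of_int j * h) m)"
    unfolding m_def v_def v'_def
    using midpoint_errors(2)[OF h(1) k convex_closed_interval sT, where n = 2 and B = B and d = "\<lambda>i j. w 0 i (of_int j * h)"]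
      dt sampled_bound_nodes h by simp
  have avg: "grid_bounded h (B * h\<^sup>2) (\<lambda>j. grid_avg (\<lambda>j. w 0 0 (of_int j * h) t) j - w 0 0 (of_int j * h) t)"
    if "t \<in> {0..T}" for t
    using that h by (intro grid_avg_error[where f = "\<lambda>i x. w i 0 x t"] dx sampled_bound_small) auto
  have Dc: "grid_bounded h (B * h\<^sup>2) (\<lambda>j. Dcentral h (\<lambda>j. w 0 0 (of_int j * h) t) j - w 1 0 (of_int j * h) t)"
    if "t \<in> {0..T}" for t
    using that h by (intro Dcentral_error[where f = "\<lambda>i x. w i 0 x t"] dx sampled_bound_small) auto
  have dispersion: "grid_bounded h (2 * B * h\<^sup>2) (\<lambda>j. dispersion h (\<lambda>j. w 0 0 (of_int j * h) t) j - w 3 0 (of_int j * h) t)"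
    if "t \<in> {0..T}" for t
    using that h by (intro dispersion_error[where f = "\<lambda>i x. w i 0 x t"] dx sampled_bound_small) auto
  have combine: "grid_bounded h (C + B * k\<^sup>2) (\<lambda>j. (A1 j + A2 j) / 2 - w a 0 (of_int j * h) m)"
    if "a < 4" "grid_bounded h C (\<lambda>j. A1 j - w a 0 (of_int j * h) s)"
      "grid_bounded h C (\<lambda>j. A2 j - w a 0 (of_int j * h) (s + k))" for a C A1 A2
    by (rule grid_bounded_weaken[OF grid_bounded_add[OF h(1)
            grid_bounded_cmult[OF h(1) grid_bounded_add[OF h(1) that(2,3)], of "1/2"] midpoint[OF that(1)]]])
      (simp_all add: field_simps)
  have lin: "grid_avg W j = (grid_avg v j + grid_avg v' j) / 2"
    "Dcentral h W j = (Dcentral h v j + Dcentral h v' j) / 2" "dispersion h W j = (dispersion h v j + dispersion h v' j) / 2" for j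
    by (simp_all add: W_def grid_avg_def Dcentral_eq dispersion_eq add_divide_distrib diff_divide_distrib)
  have P2: "grid_bounded h (B * h\<^sup>2 + B * k\<^sup>2) (\<lambda>j. Dcentral h W j - w 1 0 (of_int j * h) m)"
    unfolding lin v_def v'_def by (intro combine Dc sT) simp
  have P3: "grid_bounded h (B * h\<^sup>2 + B * k\<^sup>2) (\<lambda>j. grid_avg W j - w 0 0 (of_int j * h) m)"
    unfolding lin v_def v'_def by (intro combine avg sT) simp
  have P4: "grid_bounded h (2 * B * h\<^sup>2 + B * k\<^sup>2) (\<lambda>j. dispersion h W j - w 3 0 (of_int j * h) m)"
    unfolding lin v_def v'_def by (intro combine dispersion sT) simp
  have Wle: "\<bar>W j\<bar> \<le> B" for j
    using sup_bound[of 0 0 s "of_int j * h"] sup_bound[of 0 0 "s + k" "of_int j * h"] sT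
    unfolding W_def v_def v'_def by (auto simp: abs_le_iff)
  have avgle: "\<bar>grid_avg W j\<bar> \<le> B" for j
    using Wle[of j] Wle[of "j + 1"] Wle[of "j - 1"] by (auto simp: grid_avg_def abs_le_iff)
  have uxle: "\<bar>w 1 0 (of_int j * h) m\<bar> \<le> B" for j by (rule sup_bound) (use mT in auto)
  have "grid_bounded h (\<bar>-1\<bar> * (B * k\<^sup>2 + (2 * B * h\<^sup>2 + B * k\<^sup>2) + (B * (B * h\<^sup>2 + B * k\<^sup>2) + B * (B * h\<^sup>2 + B * k\<^sup>2))))
    (\<lambda>j. -1 * (((v' j - v j) / k - w 0 1 (of_int j * h) m) + (dispersion h W j - w 3 0 (of_int j * h) m)
      + (grid_avg W j * (Dcentral h W j - w 1 0 (of_int j * h) m)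
        + w 1 0 (of_int j * h) m * (grid_avg W j - w 0 0 (of_int j * h) m))))"
    by (intro grid_bounded_cmult grid_bounded_add grid_bounded_mult h P1 P2 P3 P4 avgle uxle)
  then show ?thesis
    unfolding v_def[symmetric] v'_def[symmetric]
  proof (rule grid_bounded_weaken)
    fix j
    define X where "X = (v' j - v j) / k"
    show "-1 * (((v' j - v j) / k - w 0 1 (of_int j * h) m) + (dispersion h W j - w 3 0 (of_int j * h) m)
      + (grid_avg W j * (Dcentral h W j - w 1 0 (of_int j * h) m)
        + w 1 0 (of_int j * h) m * (grid_avg W j - w 0 0 (of_int j * h) m))) = truncation_error h k v v' j"
      using pde[OF mT(2), of "of_int j * h"]
      unfolding truncation_error_def Let_def W_def[symmetric] X_def[symmetric] by (simp add: algebra_simps)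
  qed (use bound_nonneg in \<open>simp add: power2_eq_square algebra_simps\<close>)
qed

text \<open>
  The first summand is the Gronwall constant for fine meshes, the second one covers \<open>h > 1\<close>, and
  the third one covers time steps with \<open>3/2 * B * k > 1\<close>.
\<close>

definition error_const :: real where
  "error_const = exp (3 * B * T) * (2 * T * (2 * B + 2 * B\<^sup>2)) + 2 * B + 2 * B * (3/2 * B)\<^sup>2"

text \<open>
  The distinction is between meshes on which the Gronwall argument applies and coarse meshes, where
  the numerical solution and the exact one are each bounded by \<open>S * (1 + h)\<close> and this is dominated
  by \<open>h\<^sup>2 + k\<^sup>2\<close>.
\<close>

lemma error_bound:
  assumes h: "0 < h" and k: "0 < k" and U: "kdv_scheme h k (\<lambda>x. w 0 0 x 0) U" and N: "real N * k \<le> T"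
  shows "grid_bounded h (error_const * (h\<^sup>2 + k\<^sup>2)) (\<lambda>j. U N j - w 0 0 (of_int j * h) (real N * k))"
proof -
  define e where "e = (\<lambda>n. grid_norm h (\<lambda>j. U n j - w 0 0 (of_int j * h) (real n * k)))"
  have U2: "ell2 (U n)" for n using U by (simp add: kdv_scheme_def)
  have t: "real n * k \<in> {0..T}" if "n \<le> N" for n
  proof -
    have "real n * k \<le> real N * k" using that k by (intro mult_right_mono) auto
    then have "real n * k \<le> T" using N by linarith
    then show ?thesis using k by simp
  qed
  have nodes: "grid_bounded h (S * (1 + h)) (\<lambda>j. w 0 0 (of_int j * h) t)" if "t \<in> {0..T}" for t
    using sampled_bound[of 0 0 t h 0] h that by simp
  have w2: "ell2 (\<lambda>j. w 0 0 (of_int j * h) (real n * k))" if "n \<le> N" for n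
    by (rule grid_bounded_ell2[OF h nodes[OF t[OF that]]])
  have e2: "ell2 (\<lambda>j. U N j - w 0 0 (of_int j * h) (real N * k))"
    by (intro ell2_diff U2 w2) simp
  have const: "exp (3 * B * T) * (2 * T * (2 * B + 2 * B\<^sup>2)) \<le> error_const" "2 * B \<le> error_const"
    "2 * B * (3/2 * B)\<^sup>2 \<le> error_const"
    using bound_nonneg T0 by (auto simp: error_const_def)
  have hk: "0 \<le> h\<^sup>2 + k\<^sup>2" by simp
  have "e N \<le> error_const * (h\<^sup>2 + k\<^sup>2)"
  proof (cases "h \<le> 1 \<and> 3/4 * B * k \<le> 1/2")
    case True
    define \<tau> where "\<tau> = (2 * B + 2 * B\<^sup>2) * (h\<^sup>2 + k\<^sup>2)"
    have "e N \<le> exp (4 * (3/4 * B) * (real N * k)) * (2 * (real N * k) * \<tau>)"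
    proof (rule discrete_gronwall[where e = e and c = "3/4 * B"])
      show "e 0 = 0" using U by (simp add: e_def kdv_scheme_def grid_norm_def)
      show "0 \<le> e n" for n unfolding e_def by (rule grid_norm_nonneg[OF h])
      show "e (Suc n) - e n \<le> k * (3/4 * B * (e n + e (Suc n)) + \<tau>)" if n: "n < N" for n
      proof -
        have Suc: "real (Suc n) * k = real n * k + k" by (simp add: algebra_simps)
        have nT: "real n * k \<in> {0..T}" "real (Suc n) * k \<in> {0..T}"
          using t[of n] t[of "Suc n"] n by simp_all
        have L: "\<bar>w 0 0 (of_int (j + 1) * h) t - w 0 0 (of_int j * h) t\<bar> \<le> B * h" if "t \<in> {0..T}" for j t
          using lipschitz_bound[OF that, of "of_int (j + 1) * h" "of_int j * h"] h by (simp add: algebra_simps)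
        show ?thesis
          unfolding e_def
        proof (rule error_step[OF h k U])
          show "grid_bounded h \<tau> (truncation_error h k (\<lambda>j. w 0 0 (of_int j * h) (real n * k))
              (\<lambda>j. w 0 0 (of_int j * h) (real (Suc n) * k)))"
            unfolding Suc \<tau>_def by (rule truncation_bound) (use h True k nT(1) nT(2)[unfolded Suc] in auto)
          show "ell2 (\<lambda>j. w 0 0 (of_int j * h) (real n * k))"
            "ell2 (\<lambda>j. w 0 0 (of_int j * h) (real (Suc n) * k))"
            using n by (intro w2; simp)+
        qed (rule L[OF nT(1)] L[OF nT(2)])+
      qed
    qed (use k bound_nonneg True in \<open>auto simp: \<tau>_def\<close>)
    also have "\<dots> \<le> exp (3 * B * T) * (2 * T * \<tau>)"
      using N k bound_nonneg T0 unfolding \<tau>_def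
      by (intro mult_mono) (auto intro!: mult_left_mono simp: mult.assoc)
    also have "\<dots> = exp (3 * B * T) * (2 * T * (2 * B + 2 * B\<^sup>2)) * (h\<^sup>2 + k\<^sup>2)"
      by (simp add: \<tau>_def)
    also have "\<dots> \<le> error_const * (h\<^sup>2 + k\<^sup>2)" using const(1) hk by (rule mult_right_mono)
    finally show ?thesis .
  next
    case False
    have "grid_norm h (U N) \<le> grid_norm h (U 0)" by (rule scheme_norm_le[OF h k U])
    also have "U 0 = (\<lambda>j. w 0 0 (of_int j * h) 0)" using U by (auto simp: kdv_scheme_def)
    also have "grid_norm h \<dots> \<le> S * (1 + h)"
      using T0 by (intro grid_bounded_norm_le[OF h nodes]) auto
    finally have "grid_bounded h (S * (1 + h)) (U N)" using U2 h by (simp add: grid_bounded_iff)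
    from grid_bounded_norm_le[OF h grid_bounded_diff[OF h this nodes[OF t[OF order_refl]]]]
    have "e N \<le> B * (1 + h)" by (simp add: e_def algebra_simps)
    also have "\<dots> \<le> error_const * (h\<^sup>2 + k\<^sup>2)"
    proof (cases "h \<le> 1")
      case True
      then have "1 \<le> 3/2 * B * k" using False by simp
      then have "1 \<le> (3/2 * B * k)\<^sup>2" by simp
      then have "2 * B * 1 \<le> 2 * B * ((3/2 * B)\<^sup>2 * k\<^sup>2)"
        using bound_nonneg by (intro mult_left_mono) (auto simp: power_mult_distrib)
      moreover have "B * (1 + h) \<le> 2 * B * 1" using True bound_nonneg mult_left_mono[of "1 + h" 2 B] by simp
      moreover have "2 * B * (3/2 * B)\<^sup>2 * k\<^sup>2 \<le> error_const * k\<^sup>2"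
        using const(3) by (intro mult_right_mono) auto
      moreover have "0 \<le> error_const * h\<^sup>2" using const(2) bound_nonneg by simp
      ultimately show ?thesis by (simp add: algebra_simps)
    next
      case False
      then have "1 * h \<le> h * h" using h by (intro mult_right_mono) auto
      with False have "1 + h \<le> 2 * h\<^sup>2" unfolding power2_eq_square by linarith
      then have "B * (1 + h) \<le> B * (2 * h\<^sup>2)" using bound_nonneg by (intro mult_left_mono) auto
      moreover have "2 * B * h\<^sup>2 \<le> error_const * h\<^sup>2" using const(2) by (intro mult_right_mono) auto
      moreover have "0 \<le> error_const * k\<^sup>2" using const(2) bound_nonneg by simp
      ultimately show ?thesis by (simp add: algebra_simps)
    qed
    finally show ?thesis .
  qed
  then show ?thesis using e2 h by (simp add: grid_bounded_iff e_def)
qed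

end

text \<open>
  The derivatives in the differential equation agree with the \<open>w a b\<close> by uniqueness of derivatives.
  A common bound for the finitely many integrals is obtained by adding their absolute values.
\<close>

lemma kdv_strip_exists:
  assumes T: "0 < T" and u: "smooth_strip 6 T u" and kdv: "kdv_classical_solution T u0 u"
  obtains S w where "kdv_strip T S w" "\<And>x t. t \<in> {0..T} \<Longrightarrow> w 0 0 x t = u x t"
proof -
  from u obtain w where
    w: "\<forall>x. \<forall>t\<in>{0..T}. w 0 0 x t = u x t"
      "\<forall>a b. a + b < 6 \<longrightarrow> (\<forall>x. \<forall>t\<in>{0..T}.
        ((\<lambda>y. w a b y t) has_real_derivative w (Suc a) b x t) (at x) \<and>
        ((\<lambda>s. w a b x s) has_real_derivative w a (Suc b) x t) (at t within {0..T}))"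
      "\<forall>a b. a + b \<le> 6 \<longrightarrow>
        continuous_on (UNIV \<times> {0..T}) (\<lambda>(x, t). w a b x t) \<and>
        (\<exists>M. \<forall>t\<in>{0..T}. integrable lborel (\<lambda>x. (w a b x t)\<^sup>2) \<and>
                         (LINT x|lborel. (w a b x t)\<^sup>2) \<le> M)"
    unfolding smooth_strip_def by (elim exE conjE) (rule that)
  have w0: "w 0 0 x t = u x t" if "t \<in> {0..T}" for x t
    using w(1) that by blast
  have d: "((\<lambda>y. w a b y t) has_real_derivative w (Suc a) b x t) (at x)"
    "((\<lambda>s. w a b x s) has_real_derivative w a (Suc b) x t) (at t within {0..T})"
    if "a + b < 6" "t \<in> {0..T}" for a b x t
    using w(2) that by blast+
  have c: "continuous_on (UNIV \<times> {0..T}) (\<lambda>(x, t). w a b x t)" if "a + b \<le> 6" for a b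
    using w(3) that by blast
  have "\<forall>a b. \<exists>M. a + b \<le> 6 \<longrightarrow> (\<forall>t\<in>{0..T}. integrable lborel (\<lambda>x. (w a b x t)\<^sup>2) \<and>
                         (LINT x|lborel. (w a b x t)\<^sup>2) \<le> M)"
    using w(3) by blast
  then obtain M where "\<forall>a b. a + b \<le> 6 \<longrightarrow> (\<forall>t\<in>{0..T}. integrable lborel (\<lambda>x. (w a b x t)\<^sup>2) \<and>
                         (LINT x|lborel. (w a b x t)\<^sup>2) \<le> M a b)"
    unfolding choice_iff by (elim exE) (rule that)
  then have M: "integrable lborel (\<lambda>x. (w a b x t)\<^sup>2)" "(LINT x|lborel. (w a b x t)\<^sup>2) \<le> M a b"
    if "a + b \<le> 6" "t \<in> {0..T}" for a b t
    using that by blast+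
  define M' where "M' = (\<Sum>a\<le>6::nat. \<Sum>b\<le>6::nat. \<bar>M a b\<bar>)"
  have MM: "M a b \<le> M'" if "a + b \<le> 6" for a b
  proof -
    have "\<bar>M a b\<bar> \<le> (\<Sum>b\<le>6::nat. \<bar>M a b\<bar>)"
      using that by (intro member_le_sum[where f = "\<lambda>b. \<bar>M a b\<bar>"]) auto
    also have "\<dots> \<le> M'"
      unfolding M'_def using that by (intro member_le_sum[where f = "\<lambda>a. \<Sum>b\<le>6::nat. \<bar>M a b\<bar>"]) (auto intro: sum_nonneg)
    finally show ?thesis by simp
  qed
  have cx: "continuous_on UNIV (\<lambda>x. w a b x t)" if "a + b \<le> 6" "t \<in> {0..T}" for a b t
  proof -
    have "continuous_on UNIV ((\<lambda>(x, t). w a b x t) \<circ> (\<lambda>x. (x, t)))"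
      using that(2) by (intro continuous_on_compose continuous_intros continuous_on_subset[OF c[OF that(1)]]) auto
    then show ?thesis by (simp add: o_def)
  qed
  have "kdv_strip T (sqrt M') w"
  proof
    show "0 < T" by (rule T)
    fix a b :: nat and t h y :: real
    assume *: "a + b < 6" "t \<in> {0..T}" "0 < h"
    show "grid_bounded h (sqrt M' * (1 + h)) (\<lambda>j. w a b (of_int j * h + y) t)"
      by (rule sampling_bound[where f = "\<lambda>x. w a b x t" and f' = "\<lambda>x. w (Suc a) b x t"])
        (use * d M(1) cx in \<open>auto intro: order_trans[OF M(2) MM]\<close>)
  next
    fix x t assume t: "t \<in> {0<..<T}"
    then have t': "t \<in> {0..T}" by auto
    from kdv obtain ut ux uxx uxxx where "\<forall>x. \<forall>t\<in>{0<..<T}.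
        ((\<lambda>s. u x s) has_real_derivative ut x t) (at t) \<and>
        ((\<lambda>y. u y t) has_real_derivative ux x t) (at x) \<and>
        ((\<lambda>y. ux y t) has_real_derivative uxx x t) (at x) \<and>
        ((\<lambda>y. uxx y t) has_real_derivative uxxx x t) (at x) \<and>
        ut x t + u x t * ux x t + uxxx x t = 0"
      unfolding kdv_classical_solution_def by (elim exE conjE) (rule that)
    then have k: "((\<lambda>s. u x s) has_real_derivative ut x t) (at t)"
      "((\<lambda>y. u y t) has_real_derivative ux x t) (at x)"
      "((\<lambda>y. ux y t) has_real_derivative uxx x t) (at x)"
      "((\<lambda>y. uxx y t) has_real_derivative uxxx x t) (at x)"
      "ut x t + u x t * ux x t + uxxx x t = 0" if "t \<in> {0<..<T}" for x t
      using that by blast+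
    have "((\<lambda>s. w 0 0 x s) has_real_derivative w 0 1 x t) (at t)"
    proof -
      have "((\<lambda>s. w 0 0 x s) has_real_derivative w 0 1 x t) (at t within {0<..<T})"
        using d[of 0 0 t x] t' by (auto intro: DERIV_subset)
      then show ?thesis using t by (simp add: at_within_open[of t "{0<..<T}"])
    qed
    moreover have "((\<lambda>s. w 0 0 x s) has_real_derivative ut x t) (at t)"
      by (rule DERIV_cong_ev[THEN iffD1, rotated -1, of "\<lambda>s. u x s"])
        (use k[OF t, of x] t w0 in \<open>auto intro!: eventually_mono[OF eventually_nhds_in_open[of "{0<..<T}" t]]\<close>)
    ultimately have 1: "ut x t = w 0 1 x t" by (rule DERIV_unique[symmetric])
    have "(\<lambda>y. u y t) = (\<lambda>y. w 0 0 y t)" using w0[OF t'] by auto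
    then have 2: "ux y t = w 1 0 y t" for y
      using k[OF t, of y] d[of 0 0 t y] t' by (auto intro: DERIV_unique)
    then have 3: "uxx y t = w 2 0 y t" for y
      using k[OF t, of y] d[of 1 0 t y] t' by (auto intro: DERIV_unique simp: numeral_2_eq_2)
    then have 4: "uxxx x t = w 3 0 x t"
      using k[OF t, of x] d[of 2 0 t x] t' by (auto intro: DERIV_unique simp: numeral_3_eq_3 numeral_2_eq_2)
    show "w 0 1 x t + w 0 0 x t * w 1 0 x t + w 3 0 x t = 0"
      using k[OF t, of x] 1 2 4 w0[OF t'] by simp
  qed (use d in auto)
  then show ?thesis using w0 that by blast
qed

theorem theorem4p1:
  "\<exists>m :: nat. \<forall>(T :: real) (u0 :: real \<Rightarrow> real) (u :: real \<Rightarrow> real \<Rightarrow> real).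
     0 < T \<longrightarrow> smooth_line m u0 \<longrightarrow> smooth_strip m T u \<longrightarrow> kdv_classical_solution T u0 u \<longrightarrow>
     (\<exists>C :: real. \<forall>(\<Delta>x :: real) (\<Delta>t :: real) (U :: nat \<Rightarrow> int \<Rightarrow> real).
        0 < \<Delta>x \<longrightarrow> 0 < \<Delta>t \<longrightarrow> kdv_scheme \<Delta>x \<Delta>t u0 U \<longrightarrow>
        (\<forall>n :: nat. real n * \<Delta>t \<le> T \<longrightarrow>
           ell2 (\<lambda>j. U n j - u (of_int j * \<Delta>x) (real n * \<Delta>t)) \<and>
           grid_norm \<Delta>x (\<lambda>j. U n j - u (of_int j * \<Delta>x) (real n * \<Delta>t))
             \<le> C * (\<Delta>x\<^sup>2 + \<Delta>t\<^sup>2)))"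
proof (rule exI[of _ 6], intro allI impI)
  fix T :: real and u0 u
  assume T: "0 < T" and u: "smooth_strip 6 T u" and kdv: "kdv_classical_solution T u0 u"
  obtain S w where strip: "kdv_strip T S w" and w: "\<And>x t. t \<in> {0..T} \<Longrightarrow> w 0 0 x t = u x t"
    using kdv_strip_exists[OF T u kdv] by blast
  have u0: "u0 = (\<lambda>x. w 0 0 x 0)" using kdv w[of 0] T by (simp add: kdv_classical_solution_def)
  show "\<exists>C :: real. \<forall>(\<Delta>x :: real) (\<Delta>t :: real) (U :: nat \<Rightarrow> int \<Rightarrow> real).
        0 < \<Delta>x \<longrightarrow> 0 < \<Delta>t \<longrightarrow> kdv_scheme \<Delta>x \<Delta>t u0 U \<longrightarrow>
        (\<forall>n :: nat. real n * \<Delta>t \<le> T \<longrightarrow>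
           ell2 (\<lambda>j. U n j - u (of_int j * \<Delta>x) (real n * \<Delta>t)) \<and>
           grid_norm \<Delta>x (\<lambda>j. U n j - u (of_int j * \<Delta>x) (real n * \<Delta>t))
             \<le> C * (\<Delta>x\<^sup>2 + \<Delta>t\<^sup>2))"
  proof (rule exI[of _ "kdv_strip.error_const T S"], intro allI impI)
    fix h k :: real and U :: "nat \<Rightarrow> int \<Rightarrow> real" and n :: nat
    assume h: "0 < h" and k: "0 < k" and U: "kdv_scheme h k u0 U" and n: "real n * k \<le> T"
    have "grid_bounded h (kdv_strip.error_const T S * (h\<^sup>2 + k\<^sup>2))
        (\<lambda>j. U n j - u (of_int j * h) (real n * k))"
      using kdv_strip.error_bound[OF strip h k U[unfolded u0] n] w n k by simp
    then show "ell2 (\<lambda>j. U n j - u (of_int j * h) (real n * k)) \<and>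
        grid_norm h (\<lambda>j. U n j - u (of_int j * h) (real n * k)) \<le> kdv_strip.error_const T S * (h\<^sup>2 + k\<^sup>2)"
      by (simp add: grid_bounded_iff[OF h])
  qed
qed

end
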